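(* Let $N\ge 1$ be an integer, $\tau=T/N$, and let $u_h^0=R_hu^0$. If $\tau\gamma<2$, then the fully implicit Crank-Nicolson discontinuous Galerkin scheme has a solution, i.e. there exist $u_h^1,\dots,u_h^N\in V_h^k$ such that for every $n=1,\dots,N$ $$(D_\tau u_{h}^{n},v_{h})+(\nu + \mathrm{i}\alpha)\,a_h(\hat{u}_h^n, v_h)+(\kappa + \mathrm{i}\beta)\,(| \hat{u}^n_h |^2 \hat{u}_h^n,v_h)-\gamma\, (\hat{u}_h^n,v_h)=0\qquad \text{for all } v_h\in V_h^k .$$
   Context: Problem: $\Omega\subset\mathbb{R}^2$ is a bounded convex polygonal domain, $T>0$, and $\nu>0$, $\kappa>0$, $\alpha,\beta,\gamma$ are given real constants. $u^0$ is a sufficiently smooth complex-valued function on $\bar\Omega$ (in particular $u^0\in H^{k+1}(\Omega)$) with zero boundary trace. The scheme approximates the Ginzburg-Landau equation $u_t-(\nu+\mathrm{i}\alpha)\Delta u+(\kappa+\mathrm{i}\beta)|u|^2u-\gamma u=0$ in $\Omega\times(0,T]$ with $u=0$ on $\partial\Omega\times(0,T]$ and $u(\cdot,0)=u^0$. Inner product: $(u,v)=\int_\Omega u v^*\,\mathrm{d}\boldsymbol{x}$, where $v^*$ is the complex conjugate; $\|u\|=\sqrt{(u,u)}$. Mesh and space: $\mathcal{K}_h$ belongs to a sequence of conforming quasi-uniform triangulations of $\Omega$ with mesh size $h$ (largest element diameter); $\mathcal{E}_h$ is the set of all edges, with interior edges $\mathcal{E}_h^i$ and boundary edges $\mathcal{E}_h^b$;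 $h_E$ is the length of $E$. Each edge $E$ has a fixed unit normal $\boldsymbol{n}_E$ (outward to $\Omega$ if $E\subset\partial\Omega$). For $E\in\mathcal{E}_h^i$ shared by $K_1,K_2$, where $\boldsymbol{n}_E$ points out of $K_1$, $\{v\}=\frac12(v|_{K_1}+v|_{K_2})$ and $[v]=v|_{K_1}-v|_{K_2}$; for $E\in\mathcal{E}_h^b$, $\{v\}=[v]=v|_K$. For a fixed integer $k\ge1$, $V_h^k=\{v_h\in L^2(\Omega;\mathbb{C}): v_h|_K\in\mathbb{P}_k(K)\ \forall K\in\mathcal{K}_h\}$, with $\mathbb{P}_k(K)$ the complex polynomials of total degree at most $k$. DG norm: $\|v_h\|_{\mathrm{DG}}=\big(\sum_{K}\int_K|\nabla v_h|^2\,\mathrm{d}\boldsymbol{x}+\sum_{E\in\mathcal{E}_h}\frac1{h_E}\int_E|[v_h]|^2\,\mathrm{d}s\big)^{1/2}$. Bilinear form (with $\nabla_h$ the piecewise gradient): $$a_h(v_h,w_h)=\int_\Omega\nabla_hv_h\cdot\nabla_hw_h^*\,\mathrm{d}\boldsymbol{x}-\sum_{E\in\mathcal{E}_h}\int_E\{\nabla_hv_h\}\cdot\boldsymbol{n}_E[w_h^*]\,\mathrm{d}s-\sum_{E\in\mathcal{E}_h}\int_E[v_h]\{\nabla_hw_h^*\}\cdot\boldsymbol{n}_E\,\mathrm{d}s+\sum_{E\in\mathcal{E}_h}\frac{\lambda}{h_E}\int_E[v_h][w_h^*]\,\mathrm{d}s,$$ where the penalty parameter $\lambda$ is fixed sufficiently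 large (independently of $h$), so that there are constants $C_1,C_2>0$ independent of $h$ with $C_1\|v_h\|_{\mathrm{DG}}^2\le a_h(v_h,v_h)\le C_2\|v_h\|_{\mathrm{DG}}^2$ for all $v_h\in V_h^k$. Ritz projection: for $w\in H^{k+1}(\Omega)$, $R_hw\in V_h^k$ is defined by $a_h(R_hw,v_h)=-(\Delta w,v_h)$ for all $v_h\in V_h^k$. Time grid: $t_n=n\tau$, $D_\tau\phi^n=(\phi^n-\phi^{n-1})/\tau$, $\hat\phi^n=(\phi^n+\phi^{n-1})/2$. *)

theory Defs
  imports "HOL-Analysis.Analysis"
begin

type_synonym pt = "real^2"
type_synonym cfun = "pt \<Rightarrow> complex"

section \<open>Lebesgue and Sobolev spaces on a planar domain\<close>

text \<open>Elements of \<open>L\<^sup>2\<close> are represented by functions; only their values up to null sets matter.\<close>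

definition square_integrable :: "pt set \<Rightarrow> cfun set" where
  "square_integrable \<Omega> = {f. set_borel_measurable lebesgue \<Omega> f \<and>
     set_integrable lebesgue \<Omega> (\<lambda>x. (cmod (f x))\<^sup>2)}"

definition l2_inner :: "pt set \<Rightarrow> cfun \<Rightarrow> cfun \<Rightarrow> complex" where
  "l2_inner \<Omega> u v = (LINT x:\<Omega>|lebesgue. u x * cnj (v x))"

definition partial :: "2 \<Rightarrow> (pt \<Rightarrow> 'b::real_normed_vector) \<Rightarrow> pt \<Rightarrow> 'b" where
  "partial i f x = frechet_derivative f (at x) (axis i 1)"

text \<open>A mixed derivative is indexed by the list of its coordinate directions, so the order of the
  derivative is the length of the list.\<close>

definition partials :: "2 list \<Rightarrow> (pt \<Rightarrow> 'b::real_normed_vector) \<Rightarrow> pt \<Rightarrow> 'b" where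
  "partials is f = foldr partial is f"

definition test_function :: "pt set \<Rightarrow> (pt \<Rightarrow> real) \<Rightarrow> bool" where
  "test_function \<Omega> \<phi> \<longleftrightarrow> (\<forall>is. partials is \<phi> differentiable_on UNIV) \<and>
     compact (closure {x. \<phi> x \<noteq> 0}) \<and> closure {x. \<phi> x \<noteq> 0} \<subseteq> \<Omega>"

definition has_weak_derivative :: "pt set \<Rightarrow> 2 list \<Rightarrow> cfun \<Rightarrow> cfun \<Rightarrow> bool" where
  "has_weak_derivative \<Omega> is f g \<longleftrightarrow> (\<forall>\<phi>. test_function \<Omega> \<phi> \<longrightarrow>
     (LINT x:\<Omega>|lebesgue. f x * complex_of_real (partials is \<phi> x)) =
       (-1) ^ length is * (LINT x:\<Omega>|lebesgue. g x * complex_of_real (\<phi> x)))"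

definition sobolev :: "nat \<Rightarrow> pt set \<Rightarrow> cfun set" where
  "sobolev m \<Omega> = {f. f \<in> square_integrable \<Omega> \<and>
     (\<forall>is. length is \<le> m \<longrightarrow> (\<exists>g \<in> square_integrable \<Omega>. has_weak_derivative \<Omega> is f g))}"

text \<open>Square-integrable weak derivatives are unique up to null sets, hence the choice is immaterial.\<close>

definition weak_derivative :: "pt set \<Rightarrow> 2 list \<Rightarrow> cfun \<Rightarrow> cfun" where
  "weak_derivative \<Omega> is f =
     (SOME g. g \<in> square_integrable \<Omega> \<and> has_weak_derivative \<Omega> is f g)"

definition laplacian :: "pt set \<Rightarrow> cfun \<Rightarrow> cfun" where
  "laplacian \<Omega> f x = (\<Sum>i\<in>UNIV. weak_derivative \<Omega> [i, i] f x)"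


section \<open>Domain and meshes\<close>

definition convex_polygonal_domain :: "pt set \<Rightarrow> bool" where
  "convex_polygonal_domain \<Omega> \<longleftrightarrow>
     \<Omega> \<noteq> {} \<and> open \<Omega> \<and> bounded \<Omega> \<and> convex \<Omega> \<and> polytope (closure \<Omega>)"

text \<open>Elements are closed triangles. Conformity is part of the library notion
  \<^const>\<open>triangulation\<close>: two elements meet in a common face.\<close>

definition mesh_of :: "pt set \<Rightarrow> pt set set \<Rightarrow> bool" where
  "mesh_of \<Omega> \<K> \<longleftrightarrow> triangulation \<K> \<and> (\<forall>K\<in>\<K>. 2 simplex K) \<and> \<Union>\<K> = closure \<Omega>"

definition mesh_size :: "pt set set \<Rightarrow> real" where
  "mesh_size \<K> = Max (diameter ` \<K>)"

text \<open>Shape regularity together with comparability of all element diameters to the mesh size: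
  every element contains a ball of radius proportional to the mesh size.\<close>

definition quasi_uniform :: "(nat \<Rightarrow> pt set set) \<Rightarrow> bool" where
  "quasi_uniform \<K> \<longleftrightarrow>
     (\<exists>c>0. \<forall>m. \<forall>K\<in>\<K> m. \<exists>x. ball x (c * mesh_size (\<K> m)) \<subseteq> K)"

definition edges :: "pt set set \<Rightarrow> pt set set" where
  "edges \<K> = {E. \<exists>K\<in>\<K>. E edge_of K}"

abbreviation boundary_edge :: "pt set \<Rightarrow> pt set \<Rightarrow> bool" where
  "boundary_edge \<Omega> E \<equiv> E \<subseteq> frontier \<Omega>"

definition unit_normals :: "pt set \<Rightarrow> pt set set \<Rightarrow> (pt set \<Rightarrow> pt) \<Rightarrow> bool" where
  "unit_normals \<Omega> \<K> nrm \<longleftrightarrow> (\<forall>E\<in>edges \<K>.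
     norm (nrm E) = 1 \<and> (\<forall>x\<in>E. \<forall>y\<in>E. nrm E \<bullet> (y - x) = 0) \<and>
     (boundary_edge \<Omega> E \<longrightarrow> (\<forall>x\<in>E. \<forall>y\<in>\<Omega>. nrm E \<bullet> (y - x) < 0)))"

text \<open>The element adjacent to \<open>E\<close> out of which the normal points, and the one into which it points.
  For a boundary edge the normal is outward to the domain, so the first one is the only
  element adjacent to \<open>E\<close>.\<close>

definition elem1 :: "pt set set \<Rightarrow> (pt set \<Rightarrow> pt) \<Rightarrow> pt set \<Rightarrow> pt set" where
  "elem1 \<K> nrm E = (SOME K. K \<in> \<K> \<and> E edge_of K \<and> (\<forall>x\<in>E. \<forall>y\<in>K. nrm E \<bullet> (y - x) \<le> 0))"

definition elem2 :: "pt set set \<Rightarrow> (pt set \<Rightarrow> pt) \<Rightarrow> pt set \<Rightarrow> pt set" where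
  "elem2 \<K> nrm E = (SOME K. K \<in> \<K> \<and> E edge_of K \<and> (\<forall>x\<in>E. \<forall>y\<in>K. nrm E \<bullet> (y - x) \<ge> 0))"

text \<open>Integral with respect to arc length over a segment; it does not depend on the order of the
  endpoints.\<close>

definition edge_integral :: "pt set \<Rightarrow> (pt \<Rightarrow> 'b::real_normed_vector) \<Rightarrow> 'b" where
  "edge_integral E f = (let (a, b) = (SOME (a, b). E = closed_segment a b)
     in dist a b *\<^sub>R integral {0..1} (\<lambda>t. f (linepath a b t)))"


section \<open>Discontinuous piecewise polynomials\<close>

definition polys :: "nat \<Rightarrow> cfun set" where
  "polys k = {p. \<exists>c::nat \<Rightarrow> nat \<Rightarrow> complex. p = (\<lambda>x.
     \<Sum>i\<le>k. \<Sum>j\<le>k - i. c i j * complex_of_real (x $ 1) ^ i * complex_of_real (x $ 2) ^ j)}"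

definition dg_space :: "pt set \<Rightarrow> pt set set \<Rightarrow> nat \<Rightarrow> cfun set" where
  "dg_space \<Omega> \<K> k = {v. v \<in> square_integrable \<Omega> \<and>
     (\<forall>K\<in>\<K>. \<exists>p\<in>polys k. AE x in lebesgue. x \<in> K \<longrightarrow> v x = p x)}"

text \<open>The restriction of a piecewise polynomial to an element, as the unique polynomial agreeing
  with it almost everywhere there. Its values on the edges of the element are the
  one-sided traces.\<close>

definition restr :: "cfun \<Rightarrow> pt set \<Rightarrow> cfun" where
  "restr v K = (THE p. (\<exists>k. p \<in> polys k) \<and> (AE x in lebesgue. x \<in> K \<longrightarrow> v x = p x))"

definition grad :: "cfun \<Rightarrow> pt \<Rightarrow> complex^2" where
  "grad f x = (\<chi> i. partial i f x)"

definition jump :: "pt set \<Rightarrow> pt set set \<Rightarrow> (pt set \<Rightarrow> pt) \<Rightarrow> cfun \<Rightarrow> pt set \<Rightarrow> pt \<Rightarrow> complex" where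
  "jump \<Omega> \<K> nrm v E x =
     (if boundary_edge \<Omega> E then restr v (elem1 \<K> nrm E) x
      else restr v (elem1 \<K> nrm E) x - restr v (elem2 \<K> nrm E) x)"

definition avg_grad ::
  "pt set \<Rightarrow> pt set set \<Rightarrow> (pt set \<Rightarrow> pt) \<Rightarrow> cfun \<Rightarrow> pt set \<Rightarrow> pt \<Rightarrow> complex^2" where
  "avg_grad \<Omega> \<K> nrm v E x =
     (if boundary_edge \<Omega> E then grad (restr v (elem1 \<K> nrm E)) x
      else (1/2) *\<^sub>R (grad (restr v (elem1 \<K> nrm E)) x + grad (restr v (elem2 \<K> nrm E)) x))"

definition avg_normal_deriv ::
  "pt set \<Rightarrow> pt set set \<Rightarrow> (pt set \<Rightarrow> pt) \<Rightarrow> cfun \<Rightarrow> pt set \<Rightarrow> pt \<Rightarrow> complex" where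
  "avg_normal_deriv \<Omega> \<K> nrm v E x =
     (\<Sum>i\<in>UNIV. avg_grad \<Omega> \<K> nrm v E x $ i * complex_of_real (nrm E $ i))"

definition dg_norm :: "pt set \<Rightarrow> pt set set \<Rightarrow> (pt set \<Rightarrow> pt) \<Rightarrow> cfun \<Rightarrow> real" where
  "dg_norm \<Omega> \<K> nrm v = sqrt (
     (\<Sum>K\<in>\<K>. LINT x:K|lebesgue. (norm (grad (restr v K) x))\<^sup>2) +
     (\<Sum>E\<in>edges \<K>. 1 / diameter E * edge_integral E (\<lambda>x. (cmod (jump \<Omega> \<K> nrm v E x))\<^sup>2)))"

text \<open>Complex conjugation commutes with gradient, average and jump, so these are applied to \<open>w\<close>
  and the result is conjugated. The integral of the piecewise gradients is written element by
  element.\<close>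

definition dg_form ::
  "pt set \<Rightarrow> pt set set \<Rightarrow> (pt set \<Rightarrow> pt) \<Rightarrow> real \<Rightarrow> cfun \<Rightarrow> cfun \<Rightarrow> complex" where
  "dg_form \<Omega> \<K> nrm lam v w =
     (\<Sum>K\<in>\<K>. LINT x:K|lebesgue.
        (\<Sum>i\<in>UNIV. grad (restr v K) x $ i * cnj (grad (restr w K) x $ i)))
     - (\<Sum>E\<in>edges \<K>. edge_integral E
        (\<lambda>x. avg_normal_deriv \<Omega> \<K> nrm v E x * cnj (jump \<Omega> \<K> nrm w E x)))
     - (\<Sum>E\<in>edges \<K>. edge_integral E
        (\<lambda>x. jump \<Omega> \<K> nrm v E x * cnj (avg_normal_deriv \<Omega> \<K> nrm w E x)))
     + (\<Sum>E\<in>edges \<K>. complex_of_real (lam / diameter E) * edge_integral E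
        (\<lambda>x. jump \<Omega> \<K> nrm v E x * cnj (jump \<Omega> \<K> nrm w E x)))"

text \<open>The form is Hermitian, so \<open>a\<^sub>h(v,v)\<close> is real; the real part only converts the type.\<close>

definition coercive_and_bounded ::
  "pt set \<Rightarrow> (nat \<Rightarrow> pt set set) \<Rightarrow> (nat \<Rightarrow> pt set \<Rightarrow> pt) \<Rightarrow> nat \<Rightarrow> real \<Rightarrow> bool" where
  "coercive_and_bounded \<Omega> \<K> nrm k lam \<longleftrightarrow> (\<exists>C1>0. \<exists>C2>0. \<forall>m. \<forall>v\<in>dg_space \<Omega> (\<K> m) k.
     C1 * (dg_norm \<Omega> (\<K> m) (nrm m) v)\<^sup>2 \<le> Re (dg_form \<Omega> (\<K> m) (nrm m) lam v v) \<and>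
     Re (dg_form \<Omega> (\<K> m) (nrm m) lam v v) \<le> C2 * (dg_norm \<Omega> (\<K> m) (nrm m) v)\<^sup>2)"

text \<open>Existence, and uniqueness up to null sets, follow from coercivity.\<close>

definition ritz_projection ::
  "pt set \<Rightarrow> pt set set \<Rightarrow> (pt set \<Rightarrow> pt) \<Rightarrow> nat \<Rightarrow> real \<Rightarrow> cfun \<Rightarrow> cfun" where
  "ritz_projection \<Omega> \<K> nrm k lam w = (SOME r. r \<in> dg_space \<Omega> \<K> k \<and>
     (\<forall>v\<in>dg_space \<Omega> \<K> k. dg_form \<Omega> \<K> nrm lam r v = - l2_inner \<Omega> (laplacian \<Omega> w) v))"


section \<open>Time discretization\<close>

definition backward_diff :: "real \<Rightarrow> (nat \<Rightarrow> cfun) \<Rightarrow> nat \<Rightarrow> cfun" where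
  "backward_diff \<tau> u n x = (u n x - u (n - 1) x) / complex_of_real \<tau>"

definition time_avg :: "(nat \<Rightarrow> cfun) \<Rightarrow> nat \<Rightarrow> cfun" where
  "time_avg u n x = (u n x + u (n - 1) x) / 2"

end

(* On the finite-dimensional space V of discontinuous piecewise polynomials the form a_h is Hermitian,
   and it is definite up to null sets: a function of zero DG norm is constant on every element, without
   jumps, and zero at the boundary. Orthonormalizing a finite family of generators with respect to
   Re a_h identifies V with R^d; this already gives the Ritz projection. For a Crank-Nicolson step one
   solves for the average w of the old value u and the new one. Testing the equation with w itself, the
   real part is at least

     nu |w|^2 + (2/tau - gamma) ||w||^2 + kappa int |w|^4 - (2/tau) Re (u, w),

   which is positive on a large sphere of R^d because tau * gamma < 2. A continuous vector field on R^d
   that points outwards on a sphere has a zero; since d is not a type here, this consequence of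
   Brouwer's theorem is derived from the degree of maps of spheres in HOL-Homology. *)

theory Submission
  imports Defs "HOL-Homology.Brouwer_Degree" "HOL-Computational_Algebra.Polynomial"
begin

section \<open>Zeros of coercive vector fields\<close>

text \<open>The obstacle behind much of the proof is that the objects are chosen representatives:
  members of V are functions fixed only up to null sets, their traces come from a definite
  description, and neighbouring elements, edge endpoints and the Ritz projection come from choice
  operators. Each choice needs a candidate, and a unique one wherever its value matters; this is
  what the geometry of the mesh has to supply. V is a complex space while the degree argument wants
  real coordinates. Hence real coefficients and the real inner product Re a_h; complex test
  functions are recovered from multiples by \<i>. Solving for the average w is natural because the
  difference quotient equals (2/\<tau>)(w - u). The parameters \<alpha> and \<beta> leave no trace
  in the tested real part, since a_h(w,w) and (|w|^2 w,w) are real. Orthonormality in a_h makes the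
  dissipation exactly \<nu> R^2 on the sphere of radius R, against a term in u that grows only
  linearly in R, so no comparison of norms enters.\<close>

lemma nsphere_eq_top_of_set:
  "nsphere p = top_of_set {x. (\<forall>i\<ge>Suc p. x i = 0) \<and> (\<Sum>i\<le>p. (x i)\<^sup>2) = 1}"
  by (simp add: nsphere_def Euclidean_space_def euclidean_product_topology subtopology_subtopology
      Collect_conj_eq)

text \<open>Radial projection turns a homotopy avoiding the origin of R^(p+1) into one between
  self-maps of the sphere. \<open>N\<close> puts 0 beyond coordinate \<open>p\<close> because points
  of \<open>nsphere p\<close> are functions on the naturals vanishing there; \<open>h\<close> is
  thus free in those coordinates.\<close>

lemma homotopic_normalized:
  fixes h :: "real \<times> (nat \<Rightarrow> real) \<Rightarrow> nat \<Rightarrow> real"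
    and p :: nat
  defines "N \<equiv> \<lambda>y i. if i \<le> p then y i / sqrt (\<Sum>j\<le>p. (y j)\<^sup>2) else 0"
  assumes cont: "\<And>i. i \<le> p \<Longrightarrow> continuous_on ({0..1} \<times> topspace (nsphere p)) (\<lambda>z. h z i)"
    and nz: "\<And>t x. t \<in> {0..1} \<Longrightarrow> x \<in> topspace (nsphere p) \<Longrightarrow> \<exists>i\<le>p. h (t, x) i \<noteq> 0"
  shows "homotopic_with (\<lambda>x. True) (nsphere p) (nsphere p) (\<lambda>x. N (h (0, x))) (\<lambda>x. N (h (1, x)))"
proof -
  define S where "S = {x::nat \<Rightarrow> real. (\<forall>i\<ge>Suc p. x i = 0) \<and> (\<Sum>i\<le>p. (x i)\<^sup>2) = 1}"
  have nS: "nsphere p = top_of_set S"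
    by (simp add: nsphere_eq_top_of_set S_def)
  have pos: "(\<Sum>j\<le>p. (h z j)\<^sup>2) > 0" if "z \<in> {0..1} \<times> S" for z
  proof -
    obtain t x where z: "z = (t, x)" "t \<in> {0..1}" "x \<in> S"
      using \<open>z \<in> {0..1} \<times> S\<close> by blast
    then obtain i where "i \<le> p" "h z i \<noteq> 0"
      using nz[of t x] by (auto simp: nS)
    then show ?thesis by (intro sum_pos2[of _ i]) auto
  qed
  have c: "continuous_on ({0..1} \<times> S) (\<lambda>z. N (h z) i)" for i
  proof (cases "i \<le> p")
    case True
    have ci: "\<And>i. i \<le> p \<Longrightarrow> continuous_on ({0..1} \<times> S) (\<lambda>z. h z i)"
      using cont by (simp add: nS)
    have "sqrt (\<Sum>j\<le>p. (h z j)\<^sup>2) \<noteq> 0" if "z \<in> {0..1} \<times> S" for z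
      using pos[OF that] by simp
    then have "continuous_on ({0..1} \<times> S) (\<lambda>z. h z i / sqrt (\<Sum>j\<le>p. (h z j)\<^sup>2))"
      using ci True by (intro continuous_intros) auto
    then show ?thesis using True by (simp add: N_def)
  qed (simp add: N_def)
  have "N (h z) \<in> S" if z: "z \<in> {0..1} \<times> S" for z
  proof -
    have "(\<Sum>i\<le>p. (N (h z) i)\<^sup>2) = (\<Sum>i\<le>p. (h z i)\<^sup>2 / (\<Sum>j\<le>p. (h z j)\<^sup>2))"
      using pos[OF z] by (intro sum.cong) (auto simp: N_def power_divide less_imp_le)
    also have "\<dots> = 1"
      using pos[OF z] by (simp flip: sum_divide_distrib)
    finally show ?thesis by (simp add: S_def N_def)
  qed
  then have im: "(\<lambda>z. N (h z)) ` ({0..1} \<times> S) \<subseteq> S" by blast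
  have "continuous_on ({0..1} \<times> S) (\<lambda>z. N (h z))"
    by (intro continuous_on_coordinatewise_then_product c)
  then have "homotopic_with_canon (\<lambda>x. True) S S (\<lambda>x. N (h (0, x))) (\<lambda>x. N (h (1, x)))"
    using im by (intro homotopic_with[THEN iffD2] exI[of _ "\<lambda>z. N (h z)"])
      (auto simp: image_subset_iff)
  then show ?thesis by (simp add: nS)
qed

text \<open>Without a zero, x -> G(Rx)/|G(Rx)| would be a self-map of the sphere of degree both 0
  and 1: contracting the sphere to the origin makes it constant, and the sign condition deforms it
  linearly to the identity. For d = 0 the claim is vacuous; for d = p + 1 the sphere is
  \<open>nsphere p\<close>.\<close>

lemma coercive_zero:
  fixes G :: "(nat \<Rightarrow> real) \<Rightarrow> nat \<Rightarrow> real"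
  assumes cont: "\<And>i. i < d \<Longrightarrow> continuous_on UNIV (\<lambda>x. G x i)"
    and R: "R > 0"
    and pos: "\<And>x. (\<Sum>i<d. (x i)\<^sup>2) = R\<^sup>2 \<Longrightarrow> 0 < (\<Sum>i<d. G x i * x i)"
  shows "\<exists>x. \<forall>i<d. G x i = 0"
proof (cases d)
  case (Suc p)
  show ?thesis
  proof (rule ccontr)
    assume "\<not> ?thesis"
    then have nz: "\<exists>i\<le>p. G x i \<noteq> 0" for x
      using Suc less_Suc_eq_le by auto
    define N where "N = (\<lambda>(y::nat \<Rightarrow> real) i. if i \<le> p then y i / sqrt (\<Sum>j\<le>p. (y j)\<^sup>2) else 0)"
    \<comment> \<open>\<open>h1\<close> contracts the sphere of radius R to the origin,
      \<open>h2\<close> moves linearly from the position vector to the field; at time 1 both are the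
      field on that sphere.\<close>
    define h1 where "h1 = (\<lambda>(t::real, x::nat \<Rightarrow> real). G (\<lambda>j. R * t * x j))"
    define h2 where "h2 = (\<lambda>(t::real, x::nat \<Rightarrow> real) i. (1 - t) * x i + t * G (\<lambda>j. R * x j) i)"
    have cG: "continuous_on A (\<lambda>z. G (f z) i)" if "i \<le> p" "continuous_on A f"
      for i f and A :: "(real \<times> (nat \<Rightarrow> real)) set"
      using continuous_on_compose2[OF cont that(2)] that Suc by auto
    have cs: "continuous_on A (\<lambda>z. snd z j)" for j and A :: "(real \<times> (nat \<Rightarrow> real)) set"
      by (rule continuous_on_product_then_coordinatewise) (intro continuous_intros)
    have c1: "continuous_on A (\<lambda>z. h1 z i)" if "i \<le> p" for i A
      unfolding h1_def case_prod_unfold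
      by (intro cG that continuous_on_coordinatewise_then_product continuous_intros cs)
    have c2: "continuous_on A (\<lambda>z. h2 z i)" if "i \<le> p" for i A
      unfolding h2_def case_prod_unfold
      by (intro cG that continuous_on_coordinatewise_then_product continuous_intros cs)
    have nz2: "\<exists>i\<le>p. h2 (t, x) i \<noteq> 0" if t: "t \<in> {0..1}" and x: "x \<in> topspace (nsphere p)" for t x
    proof (rule ccontr)
      assume a: "\<not> ?thesis"
      have x1: "(\<Sum>i\<le>p. (x i)\<^sup>2) = 1" using x by (simp add: nsphere_eq_top_of_set)
      have g: "0 < (\<Sum>i\<le>p. G (\<lambda>j. R * x j) i * (R * x i))"
        using pos[of "\<lambda>j. R * x j"] x1
        by (simp add: Suc lessThan_Suc_atMost power_mult_distrib flip: sum_distrib_left)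
      \<comment> \<open>Pairing with R x splits 0 into a nonnegative multiple of 1 - t and one of t,
        with positive factors. Both vanish, which forces t = 1 and t = 0.\<close>
      have "0 = (\<Sum>i\<le>p. h2 (t, x) i * (R * x i))" using a by simp
      also have "\<dots> = (\<Sum>i\<le>p. (1 - t) * R * (x i)\<^sup>2 + t * (G (\<lambda>j. R * x j) i * (R * x i)))"
        by (intro sum.cong) (auto simp: h2_def algebra_simps power2_eq_square)
      also have "\<dots> = (1 - t) * R + t * (\<Sum>i\<le>p. G (\<lambda>j. R * x j) i * (R * x i))"
        by (simp add: sum.distrib x1 flip: sum_distrib_left)
      finally have eq: "(1 - t) * R + t * (\<Sum>i\<le>p. G (\<lambda>j. R * x j) i * (R * x i)) = 0" by simp
      have "(1 - t) * R \<ge> 0" "t * (\<Sum>i\<le>p. G (\<lambda>j. R * x j) i * (R * x i)) \<ge> 0"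
        using t R g by auto
      then have "(1 - t) * R = 0" "t * (\<Sum>i\<le>p. G (\<lambda>j. R * x j) i * (R * x i)) = 0"
        using eq by linarith+
      then show False using R g by auto
    qed
    have "homotopic_with (\<lambda>x. True) (nsphere p) (nsphere p) (\<lambda>x. N (h1 (1, x))) (\<lambda>x. N (h1 (0, x)))"
      unfolding N_def
      by (subst homotopic_with_sym, rule homotopic_normalized) (use c1 nz in \<open>auto simp: h1_def\<close>)
    moreover have "(\<lambda>x. N (h1 (0, x))) = (\<lambda>x. N (G (\<lambda>j. 0)))" by (simp add: h1_def)
    ultimately have d0: "Brouwer_degree2 p (\<lambda>x. N (h1 (1, x))) = 0"
      using Brouwer_degree2_nullhomotopic by metis
    have "homotopic_with (\<lambda>x. True) (nsphere p) (nsphere p) (\<lambda>x. N (h2 (0, x))) (\<lambda>x. N (h2 (1, x)))"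
      unfolding N_def by (rule homotopic_normalized) (use c2 nz2 in auto)
    then have "Brouwer_degree2 p (\<lambda>x. N (h2 (0, x))) = Brouwer_degree2 p (\<lambda>x. N (h2 (1, x)))"
      by (rule Brouwer_degree2_homotopic)
    moreover have "N (h2 (1, x)) = N (h1 (1, x))" for x
      by (simp add: h1_def h2_def)
    \<comment> \<open>At time 0 the normalization only divides a point of the unit sphere by its
      length 1.\<close>
    moreover have "Brouwer_degree2 p (\<lambda>x. N (h2 (0, x))) = Brouwer_degree2 p id"
      by (rule Brouwer_degree2_eq) (auto simp: nsphere_eq_top_of_set N_def h2_def fun_eq_iff)
    ultimately show False using d0 by simp
  qed
qed simp

section \<open>Polynomials\<close>

text \<open>Class C^1: continuity of the partials is what makes the volume and edge integrands
  integrable.\<close>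

definition cont_diff :: "cfun \<Rightarrow> bool" where
  "cont_diff f \<longleftrightarrow> (\<forall>x. f differentiable at x) \<and> (\<forall>i. continuous_on UNIV (partial i f))"

lemma partial_eq: "(f has_derivative f') (at x) \<Longrightarrow> partial i f x = f' (axis i 1)"
  by (metis partial_def frechet_derivative_at)

lemma partial_add:
  "f differentiable at x \<Longrightarrow> g differentiable at x \<Longrightarrow>
    partial i (\<lambda>x. f x + g x) x = partial i f x + partial i g x"
  by (rule partial_eq[THEN trans])
     (auto intro!: has_derivative_add simp: frechet_derivative_works partial_def)

lemma partial_mult:
  fixes f g :: cfun
  shows "f differentiable at x \<Longrightarrow> g differentiable at x \<Longrightarrow>
    partial i (\<lambda>x. f x * g x) x = f x * partial i g x + partial i f x * g x"
  by (rule partial_eq[THEN trans])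
     (auto intro!: has_derivative_mult simp: frechet_derivative_works partial_def)

lemma partial_cmult:
  fixes f :: cfun
  assumes "f differentiable at x"
  shows "partial i (\<lambda>x. c * f x) x = c * partial i f x"
  using assms by (subst partial_mult) (auto simp: partial_def)

lemma cont_diff_differentiable: "cont_diff f \<Longrightarrow> f differentiable at x"
  by (simp add: cont_diff_def)

lemma cont_diff_continuous_partial: "cont_diff f \<Longrightarrow> continuous_on A (partial i f)"
  using continuous_on_subset cont_diff_def by blast

lemma cont_diff_continuous: "cont_diff f \<Longrightarrow> continuous_on A f"
  by (meson continuous_at_imp_continuous_on differentiable_imp_continuous_within cont_diff_def)

lemma cont_diff_const: "cont_diff (\<lambda>x. c)"
  by (simp add: cont_diff_def partial_def[abs_def])

lemma cont_diff_coordinate: "cont_diff (\<lambda>x. complex_of_real (x $ j))"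
proof -
  have d: "((\<lambda>x::pt. complex_of_real (x $ j)) has_derivative (\<lambda>h. complex_of_real (h $ j))) (at x)" for x
    by (intro has_derivative_of_real bounded_linear_imp_has_derivative bounded_linear_vec_nth)
  have "partial i (\<lambda>x::pt. complex_of_real (x $ j)) = (\<lambda>x. complex_of_real (axis i 1 $ j))" for i
    using partial_eq[OF d] by fastforce
  then show ?thesis
    using d by (auto simp: cont_diff_def differentiable_def)
qed

lemma cont_diff_add: "cont_diff f \<Longrightarrow> cont_diff g \<Longrightarrow> cont_diff (\<lambda>x. f x + g x)"
proof -
  assume fg: "cont_diff f" "cont_diff g"
  then have "partial i (\<lambda>x. f x + g x) = (\<lambda>x. partial i f x + partial i g x)" for i
    by (intro ext partial_add cont_diff_differentiable)
  then show ?thesis using fg unfolding cont_diff_def by (auto intro!: continuous_intros)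
qed

lemma cont_diff_mult: "cont_diff f \<Longrightarrow> cont_diff g \<Longrightarrow> cont_diff (\<lambda>x. f x * g x)"
proof -
  assume fg: "cont_diff f" "cont_diff g"
  then have "partial i (\<lambda>x. f x * g x) = (\<lambda>x. f x * partial i g x + partial i f x * g x)" for i
    by (intro ext partial_mult cont_diff_differentiable)
  then show ?thesis
    using fg cont_diff_continuous[of f UNIV] cont_diff_continuous[of g UNIV]
    unfolding cont_diff_def by (auto intro!: continuous_intros)
qed

lemma cont_diff_sum: "(\<And>i. i \<in> A \<Longrightarrow> cont_diff (f i)) \<Longrightarrow> cont_diff (\<lambda>x. \<Sum>i\<in>A. f i x)"
  by (induction A rule: infinite_finite_induct) (auto intro: cont_diff_add cont_diff_const)

lemma cont_diff_power: "cont_diff f \<Longrightarrow> cont_diff (\<lambda>x. f x ^ n)"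
  by (induction n) (auto intro: cont_diff_mult cont_diff_const)

lemma polys_cont_diff: "p \<in> polys k \<Longrightarrow> cont_diff p"
  unfolding polys_def
  by (auto intro!: cont_diff_sum cont_diff_mult cont_diff_power cont_diff_coordinate cont_diff_const)

section \<open>Algebra of polynomials and their uniqueness\<close>

lemma polys_add: 
  assumes "p \<in> polys k" "q \<in> polys k" shows "(\<lambda>x. p x + q x) \<in> polys k"
proof -
  obtain c where c: "p = (\<lambda>x. \<Sum>i\<le>k. \<Sum>j\<le>k - i. c i j * complex_of_real (x $ 1) ^ i * complex_of_real (x $ 2) ^ j)"
    using assms by (auto simp: polys_def)
  obtain d where d: "q = (\<lambda>x. \<Sum>i\<le>k. \<Sum>j\<le>k - i. d i j * complex_of_real (x $ 1) ^ i * complex_of_real (x $ 2) ^ j)"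
    using assms by (auto simp: polys_def)
  show ?thesis
    unfolding polys_def c d
    by (rule CollectI, rule exI[of _ "\<lambda>i j. c i j + d i j"]) (simp add: sum.distrib distrib_right)
qed

lemma polys_cmult:
  assumes "p \<in> polys k" shows "(\<lambda>x. a * p x) \<in> polys k"
proof -
  obtain c where c: "p = (\<lambda>x. \<Sum>i\<le>k. \<Sum>j\<le>k - i. c i j * complex_of_real (x $ 1) ^ i * complex_of_real (x $ 2) ^ j)"
    using assms by (auto simp: polys_def)
  show ?thesis
    unfolding polys_def c
    by (rule CollectI, rule exI[of _ "\<lambda>i j. a * c i j"]) (simp add: sum_distrib_left mult.assoc)
qed

text \<open>Restriction to a line leads back to one variable, where finitely many roots decide
  equality.\<close>

lemma polys_line:
  assumes "p \<in> polys k"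
  obtains P where "\<And>t. p (a + t *\<^sub>R d) = poly P (complex_of_real t)"
proof -
  obtain c where c: "p = (\<lambda>x. \<Sum>i\<le>k. \<Sum>j\<le>k - i. c i j * complex_of_real (x $ 1) ^ i * complex_of_real (x $ 2) ^ j)"
    using assms by (auto simp: polys_def)
  show ?thesis
    by (rule that[of "\<Sum>i\<le>k. \<Sum>j\<le>k - i. Polynomial.smult (c i j)
          ([:complex_of_real (a $ 1), complex_of_real (d $ 1):] ^ i *
           [:complex_of_real (a $ 2), complex_of_real (d $ 2):] ^ j)"])
       (simp add: c poly_sum poly_power mult.assoc)
qed

text \<open>Join \<open>a\<close> to an arbitrary point by a line: the parameters landing in
  \<open>U\<close> form a nonempty open set, hence an infinite one, and univariate polynomials
  agreeing there coincide. The degree bounds may differ, as \<open>restr\<close> leaves the degree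
  open.\<close>

lemma polys_eq_of_eq_on_open:
  assumes p: "p \<in> polys k" and q: "q \<in> polys l"
    and U: "open U" "a \<in> U" and eq: "\<And>x. x \<in> U \<Longrightarrow> p x = q x"
  shows "p = q"
proof
  fix x
  obtain P where P: "\<And>t. p (a + t *\<^sub>R (x - a)) = poly P (complex_of_real t)"
    using polys_line[OF p] by metis
  obtain Q where Q: "\<And>t. q (a + t *\<^sub>R (x - a)) = poly Q (complex_of_real t)"
    using polys_line[OF q] by metis
  have "open ((\<lambda>t. a + t *\<^sub>R (x - a)) -` U)"
    using U(1) by (intro open_vimage continuous_intros)
  moreover have "(0::real) \<in> (\<lambda>t. a + t *\<^sub>R (x - a)) -` U" using U by simp
  ultimately have "infinite ((\<lambda>t. a + t *\<^sub>R (x - a)) -` U)"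
    using finite_imp_not_open by blast
  then have "infinite (complex_of_real ` ((\<lambda>t. a + t *\<^sub>R (x - a)) -` U))"
    using finite_imageD inj_of_real by (metis inj_on_subset subset_UNIV)
  moreover have "complex_of_real ` ((\<lambda>t. a + t *\<^sub>R (x - a)) -` U) \<subseteq> {z. poly (P - Q) z = 0}"
    using eq P Q by fastforce
  ultimately have "infinite {z. poly (P - Q) z = 0}" using infinite_super by blast
  then have "P - Q = 0" using poly_roots_finite by blast
  then show "p x = q x" using P[of 1] Q[of 1] by simp
qed

text \<open>The set of disagreement inside the interior is open by continuity and negligible by
  assumption, so it is empty.\<close>

lemma AE_eq_imp_eq_on_interior:
  fixes f g :: "'a::euclidean_space \<Rightarrow> 'b::real_normed_vector"
  assumes f: "continuous_on (interior K) f" and g: "continuous_on (interior K) g"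
    and eq: "AE x in lebesgue. x \<in> K \<longrightarrow> f x = g x" and x: "x \<in> interior K"
  shows "f x = g x"
proof (rule ccontr)
  assume ne: "f x \<noteq> g x"
  let ?D = "{x \<in> interior K. f x - g x \<in> - {0}}"
  have o: "open ?D"
    using continuous_open_preimage[OF continuous_on_diff[OF f g] open_interior, of "-{0}"]
    by (simp add: vimage_def Int_def open_Compl)
  obtain N where N: "{x. \<not> (x \<in> K \<longrightarrow> f x = g x)} \<subseteq> N" "negligible N"
    using eq by (auto simp: eventually_ae_filter negligible_iff_null_sets)
  have "?D \<subseteq> N" using N(1) interior_subset[of K] by auto
  then have "negligible ?D" using N(2) negligible_subset by blast
  moreover have "x \<in> ?D" using ne x by simp
  ultimately show False using open_not_negligible[OF o] by blast
qed

lemma polys_AE_unique: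
  assumes p: "p \<in> polys k" and q: "q \<in> polys l" and "interior K \<noteq> {}"
    and eq: "AE x in lebesgue. x \<in> K \<longrightarrow> p x = q x"
  shows "p = q"
proof -
  obtain a where "a \<in> interior K" using assms(3) by blast
  then show ?thesis
    using AE_eq_imp_eq_on_interior[OF _ _ eq] cont_diff_continuous polys_cont_diff p q
    by (intro polys_eq_of_eq_on_open[OF p q open_interior]) blast+
qed

text \<open>This evaluates the definite description in \<open>restr\<close>: a candidate of any
  degree agrees with \<open>p\<close> almost everywhere on a set with interior, so it is
  \<open>p\<close>. Linearity of traces and gradients rests on it.\<close>

lemma restr_eq:
  assumes "p \<in> polys k" and "interior K \<noteq> {}" and "AE x in lebesgue. x \<in> K \<longrightarrow> v x = p x"
  shows "restr v K = p"
  unfolding restr_def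
proof (rule the_equality)
  fix q assume q: "(\<exists>k. q \<in> polys k) \<and> (AE x in lebesgue. x \<in> K \<longrightarrow> v x = q x)"
  then have "AE x in lebesgue. x \<in> K \<longrightarrow> q x = p x"
    using assms(3) by (auto elim!: eventually_elim2)
  then show "q = p" using q assms polys_AE_unique by blast
qed (use assms in blast)

lemma restr_cong_AE:
  assumes "AE x in lebesgue. x \<in> K \<longrightarrow> v x = w x"
  shows "restr v K = restr w K"
proof -
  have "(AE x in lebesgue. x \<in> K \<longrightarrow> v x = p x) \<longleftrightarrow> (AE x in lebesgue. x \<in> K \<longrightarrow> w x = p x)" for p
    using assms by (auto elim!: eventually_elim2)
  then show ?thesis unfolding restr_def by simp
qed

section \<open>Geometry of the mesh\<close>

text \<open>Orthogonality puts the edge on a line, and a one-dimensional affine subspace of a line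
  is the whole line.\<close>

lemma edge_affine_hull:
  fixes E :: "pt set"
  assumes dim: "aff_dim E = 1" and n: "n \<noteq> 0"
    and orth: "\<forall>x\<in>E. \<forall>y\<in>E. n \<bullet> (y - x) = 0" and a: "a \<in> E"
  shows "affine hull E = {y. n \<bullet> y = n \<bullet> a}"
proof (rule affine_dim_equal)
  have "n \<bullet> y = n \<bullet> a" if "y \<in> E" for y
    using bspec[OF bspec[OF orth a] that] by (simp add: inner_diff_right)
  then have "E \<subseteq> {y. n \<bullet> y = n \<bullet> a}" by blast
  then show "affine hull E \<subseteq> {y. n \<bullet> y = n \<bullet> a}"
    by (simp add: hull_minimal affine_hyperplane)
qed (use dim n a in \<open>auto simp: affine_hyperplane\<close>)

text \<open>Points of \<open>K\<close> strictly on both sides would be joined by a segment crossing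
  the line inside \<open>K\<close>. A face is the part of \<open>K\<close> in its affine hull, so
  the crossing point is in \<open>E\<close>, and the face property pulls the endpoints onto the
  line.\<close>

lemma edge_one_side:
  fixes K :: "pt set"
  assumes K: "convex K" and E: "E edge_of K" and n: "n \<noteq> 0"
    and orth: "\<forall>x\<in>E. \<forall>y\<in>E. n \<bullet> (y - x) = 0" and a: "a \<in> E"
  shows "(\<forall>y\<in>K. n \<bullet> (y - a) \<le> 0) \<or> (\<forall>y\<in>K. n \<bullet> (y - a) \<ge> 0)"
proof (rule ccontr)
  assume "\<not> ?thesis"
  then obtain y z where y: "y \<in> K" "n \<bullet> (y - a) > 0" and z: "z \<in> K" "n \<bullet> (z - a) < 0"
    by (meson not_le)
  \<comment> \<open>The parameter at which a multiple of the signed distance to the line vanishes on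
    the segment from \<open>y\<close> to \<open>z\<close>.\<close>
  define u where "u = n \<bullet> (y - a) / (n \<bullet> (y - a) - n \<bullet> (z - a))"
  have u: "0 < u" "u < 1" using y z by (simp_all add: u_def)
  define q where "q = (1 - u) *\<^sub>R y + u *\<^sub>R z"
  have ueq: "u * (n \<bullet> (y - a) - n \<bullet> (z - a)) = n \<bullet> (y - a)"
    using y z by (simp add: u_def)
  have "n \<bullet> (q - a) = n \<bullet> (y - a) - u * (n \<bullet> (y - a) - n \<bullet> (z - a))"
    by (simp add: q_def inner_diff_right inner_add_right algebra_simps)
  then have "n \<bullet> q = n \<bullet> a" using ueq by (simp add: inner_diff_right)
  then have "q \<in> affine hull E"
    using edge_affine_hull[OF _ n orth a] E by (simp add: edge_of_def)
  moreover have "y \<noteq> z" using y z by auto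
  then have qs: "q \<in> open_segment y z"
    using u by (auto simp: in_segment q_def)
  moreover have "q \<in> K"
    using qs y z K by (meson convex_contains_open_segment subsetD)
  ultimately have "q \<in> E"
    using face_of_imp_eq_affine_Int[OF K] E by (auto simp: edge_of_def)
  then have "y \<in> E" using E qs y z face_ofD[of E K q y z] by (auto simp: edge_of_def)
  then have "n \<bullet> (y - a) = 0" using orth a by blast
  then show False using y by simp
qed

text \<open>Close to a relative interior point of a common edge, the segment towards a point of one set
  already runs inside the other set.\<close>

lemma same_side_overlap:
  fixes K K' :: "pt set"
  assumes K: "convex K" "convex K'" and E: "E edge_of K" "E edge_of K'" and n: "n \<noteq> 0"
    and orth: "\<forall>x\<in>E. \<forall>y\<in>E. n \<bullet> (y - x) = 0" and a: "a \<in> E"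
    and y: "y \<in> K" "n \<bullet> (y - a) < 0" and y': "y' \<in> K'" "n \<bullet> (y' - a) < 0"
  shows "\<exists>q\<in>K \<inter> K'. q \<notin> E"
proof -
  have "convex E" using E face_of_imp_convex by (auto simp: edge_of_def)
  then obtain p where p: "p \<in> rel_interior E"
    using rel_interior_eq_empty a by blast
  then obtain e where e: "e > 0" "cball p e \<inter> affine hull E \<subseteq> E" and pE: "p \<in> E"
    by (auto simp: mem_rel_interior_cball)
  have hull: "affine hull E = {y. n \<bullet> y = n \<bullet> p}"
    using edge_affine_hull[OF _ n orth pE] E by (simp add: edge_of_def)
  have np: "n \<bullet> p = n \<bullet> a"
    using bspec[OF bspec[OF orth a] pE] by (simp add: inner_diff_right)
  \<comment> \<open>The ratio of the distances of \<open>y\<close> and \<open>y'\<close> from the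
    edge line, so that \<open>w\<close> below is parallel to the edge.\<close>
  define \<theta> where "\<theta> = n \<bullet> (y - p) / (n \<bullet> (y' - p))"
  have neg: "n \<bullet> (y - p) < 0" "n \<bullet> (y' - p) < 0"
    using y y' np by (auto simp: inner_diff_right)
  have \<theta>: "\<theta> > 0" using neg by (simp add: \<theta>_def divide_neg_neg)
  define w where "w = y - p - \<theta> *\<^sub>R (y' - p)"
  have w: "n \<bullet> w = 0"
    using neg(2) unfolding w_def inner_diff_right[of n "y - p"] inner_scaleR_right \<theta>_def by simp
  \<comment> \<open>The three bounds in turn keep \<open>q\<close> on the segment from
    \<open>p\<close> to \<open>y\<close>, keep 1 - s \<theta> at least 1/2, and keep
    \<open>r\<close> within distance \<open>e\<close> of \<open>p\<close>; the + 1 covers w =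
    0.\<close>
  define s where "s = min 1 (min (1 / (2 * \<theta>)) (e / (2 * norm w + 1)))"
  have s: "0 < s" "s \<le> 1" 
  proof -
    have "e / (2 * norm w + 1) > 0" using e by (intro divide_pos_pos add_nonneg_pos) auto
    then show "0 < s" using \<theta> by (simp add: s_def)
  qed (simp add: s_def)
  have "s \<le> 1 / (2 * \<theta>)" by (simp add: s_def)
  then have s\<theta>: "s * \<theta> \<le> 1 / 2" using \<theta> by (simp add: field_simps)
  have "s \<le> e / (2 * norm w + 1)" by (simp add: s_def)
  then have "s * (2 * norm w + 1) \<le> e" by (subst (asm) pos_le_divide_eq) (auto intro: add_nonneg_pos)
  then have sw: "2 * s * norm w \<le> e" using s by (simp add: algebra_simps)
  \<comment> \<open>\<open>r\<close> is the point of the edge line from which the segment towards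
    \<open>y'\<close> passes through \<open>q\<close>.\<close>
  define r where "r = p + (s / (1 - s * \<theta>)) *\<^sub>R w"
  have "norm ((s / (1 - s * \<theta>)) *\<^sub>R w) = s * norm w / (1 - s * \<theta>)"
    using s s\<theta> by simp
  also have "\<dots> \<le> s * norm w / (1 / 2)"
    using s s\<theta> by (intro divide_left_mono) auto
  also have "\<dots> \<le> e" using sw by simp
  finally have "r \<in> cball p e" by (simp add: r_def dist_norm)
  moreover have "r \<in> affine hull E" using w by (simp add: hull r_def inner_add_right)
  ultimately have "r \<in> K'" using e E edge_of_imp_subset by blast
  define q where "q = (1 - s) *\<^sub>R p + s *\<^sub>R y"
  have "q = (1 - s * \<theta>) *\<^sub>R r + (s * \<theta>) *\<^sub>R y'"
  proof -
    have "(1 - s * \<theta>) *\<^sub>R r = (1 - s * \<theta>) *\<^sub>R p + s *\<^sub>R w"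
      using s\<theta> by (simp add: r_def scaleR_add_right)
    then show ?thesis by (simp add: q_def w_def algebra_simps)
  qed
  then have "q \<in> K'"
    using convexD[OF K(2) \<open>r \<in> K'\<close> y'(1), of "1 - s * \<theta>" "s * \<theta>"] s \<theta> s\<theta> by simp
  moreover have "q \<in> K"
    using convexD[OF K(1) _ y(1), of p "1 - s" s] pE edge_of_imp_subset[OF E(1)] s
    by (auto simp: q_def)
  moreover have "q \<notin> E"
  proof
    assume "q \<in> E"
    then have "n \<bullet> (q - p) = 0" using orth pE by blast
    moreover have "n \<bullet> (q - p) = s * (n \<bullet> (y - p))"
      by (simp add: q_def inner_diff_right inner_add_right algebra_simps)
    ultimately show False using s neg by simp
  qed
  ultimately show ?thesis by blast
qed

section \<open>Elements, edges and adjacency in one mesh\<close>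

locale dg_mesh =
  fixes \<Omega> :: "pt set" and \<T> :: "pt set set" and nrm :: "pt set \<Rightarrow> pt"
  assumes domain: "convex_polygonal_domain \<Omega>" and mesh: "mesh_of \<Omega> \<T>"
    and normals: "unit_normals \<Omega> \<T> nrm"
begin

lemma domain_props: "\<Omega> \<noteq> {}" "open \<Omega>" "bounded \<Omega>" "convex \<Omega>"
  using domain by (auto simp: convex_polygonal_domain_def)

lemma interior_closure_domain: "interior (closure \<Omega>) = \<Omega>"
  using domain_props by (simp add: convex_interior_closure interior_open)

lemma finite_elements: "finite \<T>"
  using mesh by (auto simp: mesh_of_def triangulation_def)

lemma Union_elements: "\<Union>\<T> = closure \<Omega>"
  using mesh by (simp add: mesh_of_def)

lemma Int_face_of: "K \<in> \<T> \<Longrightarrow> K' \<in> \<T> \<Longrightarrow> K \<inter> K' face_of K"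
  using mesh by (auto simp: mesh_of_def triangulation_def)

context
  fixes K assumes K: "K \<in> \<T>"
begin

lemma element_simplex: "2 simplex K"
  using mesh K by (auto simp: mesh_of_def)

lemma element_convex: "convex K"
  using element_simplex convex_simplex by blast

lemma element_compact: "compact K"
  using element_simplex compact_simplex by blast

lemma element_closed: "closed K"
  using element_compact compact_imp_closed by blast

lemma element_dim: "aff_dim K = 2"
  using element_simplex aff_dim_simplex by blast

lemma element_interior: "interior K \<noteq> {}"
proof -
  have "affine hull K = UNIV"
    using element_dim by (simp flip: aff_dim_eq_full)
  then have "interior K = rel_interior K" by (simp add: rel_interior_interior)
  moreover have "K \<noteq> {}" using element_dim by auto
  ultimately show ?thesis using element_convex by (simp add: rel_interior_eq_empty)
qed

lemma element_subset: "K \<subseteq> closure \<Omega>"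
  using Union_elements K by blast

lemma element_edges: "E edge_of K \<Longrightarrow> E \<in> edges \<T>"
  using K by (auto simp: edges_def)

end

text \<open>The common face of two distinct triangles is a proper face of at least one of them, and
  proper faces lose dimension.\<close>

lemma Int_dim:
  assumes "K \<in> \<T>" "K' \<in> \<T>" "K \<noteq> K'"
  shows "aff_dim (K \<inter> K') \<le> 1"
proof -
  have f: "K \<inter> K' face_of K" "K \<inter> K' face_of K'"
    using Int_face_of[of K K'] Int_face_of[of K' K] assms by (simp_all add: Int_commute)
  have "K \<inter> K' \<noteq> K \<or> K \<inter> K' \<noteq> K'" using assms(3) by blast
  then have "aff_dim (K \<inter> K') < 2"
    using face_of_aff_dim_lt[OF element_convex f(1)] face_of_aff_dim_lt[OF element_convex f(2)]
      assms(1,2) element_dim by auto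
  then show ?thesis by simp
qed

lemma Int_negligible:
  assumes "K \<in> \<T>" "K' \<in> \<T>" "K \<noteq> K'"
  shows "negligible (K \<inter> K')"
  using Int_dim[OF assms] assms element_convex aff_dim_nonempty_interior[of "K \<inter> K'"]
  by (fastforce simp: negligible_convex_interior convex_Int)

lemma edge_normal:
  assumes "E \<in> edges \<T>"
  shows "norm (nrm E) = 1" "nrm E \<noteq> 0" "\<forall>x\<in>E. \<forall>y\<in>E. nrm E \<bullet> (y - x) = 0"
  using normals assms by (auto simp: unit_normals_def)

text \<open>Two elements on the same side would overlap outside \<open>E\<close>. Then
  \<open>E\<close> is a proper face of their intersection, whose dimension exceeds 1, contrary to
  conformity. The vector \<open>n\<close> is kept general so that \<open>- nrm E\<close> handles the
  other side.\<close>

lemma edge_element_unique: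
  assumes K: "K \<in> \<T>" "K' \<in> \<T>" and E: "E edge_of K" "E edge_of K'" and n: "n \<noteq> 0"
    and orth: "\<forall>x\<in>E. \<forall>y\<in>E. n \<bullet> (y - x) = 0"
    and side: "\<forall>x\<in>E. \<forall>y\<in>K. n \<bullet> (y - x) \<le> 0" "\<forall>x\<in>E. \<forall>y\<in>K'. n \<bullet> (y - x) \<le> 0"
  shows "K = K'"
proof (rule ccontr)
  assume ne: "K \<noteq> K'"
  have "E \<noteq> {}" using E by (auto simp: edge_of_def)
  then obtain a where a: "a \<in> E" by blast
  \<comment> \<open>A triangle does not fit into a line, so weak one-sidedness yields a point
    strictly on the negative side.\<close>
  have strict: "\<exists>y\<in>L. n \<bullet> (y - a) < 0" if "L \<in> \<T>" "\<forall>x\<in>E. \<forall>y\<in>L. n \<bullet> (y - x) \<le> 0" for L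
  proof (rule ccontr)
    assume "\<not> ?thesis"
    then have "L \<subseteq> {y. n \<bullet> y = n \<bullet> a}"
      using that(2) a by (metis (mono_tags, lifting) inner_diff_right diff_le_0_iff_le
          eq_iff_diff_eq_0 mem_Collect_eq not_less_iff_gr_or_eq less_le subsetI)
    then have "aff_dim L \<le> aff_dim {y. n \<bullet> y = n \<bullet> a}" by (rule aff_dim_subset)
    then show False using n element_dim[OF that(1)] by simp
  qed
  obtain q where q: "q \<in> K \<inter> K'" "q \<notin> E"
    using same_side_overlap[OF element_convex element_convex E n orth a] strict K side by metis
  have sub: "E \<subseteq> K \<inter> K'" using E edge_of_imp_subset by blast
  have "E face_of K \<inter> K'"
    using face_of_face[OF Int_face_of[OF K]] E sub by (auto simp: edge_of_def)
  moreover have "convex (K \<inter> K')" using K element_convex by (auto intro: convex_Int)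
  moreover have "E \<noteq> K \<inter> K'" using q by blast
  ultimately have "aff_dim E < aff_dim (K \<inter> K')" using face_of_aff_dim_lt by blast
  then show False using Int_dim[OF K ne] E by (simp add: edge_of_def)
qed

text \<open>The choice in \<open>elem1\<close> has only one candidate, so an element on the right
  side must be its value.\<close>

lemma elem1_eq:
  assumes K: "K \<in> \<T>" and E: "E edge_of K" and side: "\<forall>x\<in>E. \<forall>y\<in>K. nrm E \<bullet> (y - x) \<le> 0"
  shows "elem1 \<T> nrm E = K"
  unfolding elem1_def
proof (rule some_equality)
  fix K' assume "K' \<in> \<T> \<and> E edge_of K' \<and> (\<forall>x\<in>E. \<forall>y\<in>K'. nrm E \<bullet> (y - x) \<le> 0)"
  then show "K' = K"
    using edge_element_unique[of K' K E "nrm E"] edge_normal[OF element_edges] assms by blast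
qed (use assms in blast)

lemma elem2_eq:
  assumes K: "K \<in> \<T>" and E: "E edge_of K" and side: "\<forall>x\<in>E. \<forall>y\<in>K. nrm E \<bullet> (y - x) \<ge> 0"
  shows "elem2 \<T> nrm E = K"
  unfolding elem2_def
proof (rule some_equality)
  fix K' assume "K' \<in> \<T> \<and> E edge_of K' \<and> (\<forall>x\<in>E. \<forall>y\<in>K'. nrm E \<bullet> (y - x) \<ge> 0)"
  then show "K' = K"
    using edge_element_unique[of K' K E "- nrm E"] edge_normal[OF element_edges[OF K E]] assms
    by simp
qed (use assms in blast)

lemma element_side:
  assumes K: "K \<in> \<T>" and E: "E edge_of K"
  shows "(\<forall>x\<in>E. \<forall>y\<in>K. nrm E \<bullet> (y - x) \<le> 0) \<or> (\<forall>x\<in>E. \<forall>y\<in>K. nrm E \<bullet> (y - x) \<ge> 0)"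
proof -
  have "E \<noteq> {}" using E by (auto simp: edge_of_def)
  then obtain a where a: "a \<in> E" by blast
  note n = edge_normal[OF element_edges[OF K E]]
  have "nrm E \<bullet> x = nrm E \<bullet> a" if "x \<in> E" for x
    using bspec[OF bspec[OF n(3) a] that] by (simp add: inner_diff_right)
  then show ?thesis
    using edge_one_side[OF element_convex[OF K] E n(2,3) a] by (simp add: inner_diff_right)
qed

text \<open>The point rules out the smaller dimensions: it makes the face nonempty, and being no
  vertex it cannot be the whole face.\<close>

lemma face_is_edge:
  assumes F: "F face_of K" and p: "p \<in> F" "\<not> p extreme_point_of K" and dim: "aff_dim F \<le> 1"
  shows "F edge_of K"
proof -
  have "F \<noteq> {p}" using p F face_of_singleton by blast
  then have "aff_dim F \<noteq> 0" using p by (auto simp: aff_dim_eq_0)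
  moreover have "aff_dim F \<ge> 0" using p by (metis aff_dim_negative_iff empty_iff not_less)
  ultimately show ?thesis using F dim by (simp add: edge_of_def)
qed

text \<open>Away from the vertices a shared point lies on a shared edge, and uniqueness on each side
  puts the two elements on opposite sides. Only the unordered pair is determined, because the normal
  of an interior edge may point either way.\<close>

lemma interior_point_neighbours:
  assumes K: "K \<in> \<T>" "K' \<in> \<T>" "K \<noteq> K'" and p: "p \<in> K \<inter> K'" "p \<in> \<Omega>" "\<not> p extreme_point_of K"
  shows "K \<inter> K' edge_of K" "\<not> boundary_edge \<Omega> (K \<inter> K')"
    "{elem1 \<T> nrm (K \<inter> K'), elem2 \<T> nrm (K \<inter> K')} = {K, K'}"
proof -
  define E where "E = K \<inter> K'"
  have E: "E edge_of K"
    using face_is_edge[OF Int_face_of] K p Int_dim by (auto simp: E_def)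
  then have E': "E edge_of K'"
    using Int_face_of[OF K(2,1)] by (simp add: edge_of_def E_def Int_commute)
  note n = edge_normal[OF element_edges[OF K(1) E]]
  have "p \<in> E" using p by (simp add: E_def)
  moreover have "p \<notin> frontier \<Omega>" using p domain_props(2) by (simp add: frontier_def interior_open)
  ultimately have nb: "\<not> boundary_edge \<Omega> E" by blast
  have "\<not> ((\<forall>x\<in>E. \<forall>y\<in>K. nrm E \<bullet> (y - x) \<le> 0) \<and> (\<forall>x\<in>E. \<forall>y\<in>K'. nrm E \<bullet> (y - x) \<le> 0))"
    using edge_element_unique[OF K(1,2) E E' n(2,3)] K(3) by blast
  moreover have "\<not> ((\<forall>x\<in>E. \<forall>y\<in>K. nrm E \<bullet> (y - x) \<ge> 0) \<and> (\<forall>x\<in>E. \<forall>y\<in>K'. nrm E \<bullet> (y - x) \<ge> 0))"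
    using edge_element_unique[OF K(1,2) E E', of "- nrm E"] n(2,3) K(3)
    by (simp, blast)
  ultimately consider
      "\<forall>x\<in>E. \<forall>y\<in>K. nrm E \<bullet> (y - x) \<le> 0" "\<forall>x\<in>E. \<forall>y\<in>K'. nrm E \<bullet> (y - x) \<ge> 0"
    | "\<forall>x\<in>E. \<forall>y\<in>K. nrm E \<bullet> (y - x) \<ge> 0" "\<forall>x\<in>E. \<forall>y\<in>K'. nrm E \<bullet> (y - x) \<le> 0"
    using element_side[OF K(1) E] element_side[OF K(2) E'] by argo
  then have "{elem1 \<T> nrm E, elem2 \<T> nrm E} = {K, K'}"
  proof cases
    case 1 then show ?thesis using elem1_eq[OF K(1) E] elem2_eq[OF K(2) E'] by simp
  next
    case 2 then show ?thesis using elem1_eq[OF K(2) E'] elem2_eq[OF K(1) E] by auto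
  qed
  then show "{elem1 \<T> nrm (K \<inter> K'), elem2 \<T> nrm (K \<inter> K')} = {K, K'}"
    by (simp only: E_def)
  show "K \<inter> K' edge_of K" using E by (simp only: E_def)
  show "\<not> boundary_edge \<Omega> (K \<inter> K')" using nb unfolding E_def .
qed

text \<open>The outward normal puts the domain, hence its closure and \<open>K\<close>, in the
  closed half-plane behind the edge line.\<close>

lemma elem1_boundary_edge:
  assumes K: "K \<in> \<T>" and E: "E edge_of K" and b: "boundary_edge \<Omega> E"
  shows "elem1 \<T> nrm E = K"
proof -
  have "nrm E \<bullet> (y - x) \<le> 0" if "x \<in> E" "y \<in> K" for x y
  proof -
    have "nrm E \<bullet> y' \<le> nrm E \<bullet> x" if "y' \<in> \<Omega>" for y'
    proof -
      have "nrm E \<bullet> (y' - x) < 0"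
        using normals b element_edges[OF K E] \<open>x \<in> E\<close> that by (auto simp: unit_normals_def)
      then show ?thesis by (simp add: inner_diff_right)
    qed
    moreover have "y \<in> closure \<Omega>" using element_subset[OF K] that by blast
    ultimately have "nrm E \<bullet> y \<le> nrm E \<bullet> x"
      by (intro continuous_le_on_closure[of \<Omega> "\<lambda>y. nrm E \<bullet> y" y]) (auto intro!: continuous_intros)
    then show ?thesis by (simp add: inner_diff_right)
  qed
  then show ?thesis using elem1_eq[OF K E] by blast
qed

text \<open>A supporting line of the domain at \<open>p\<close> cuts \<open>K\<close> in a face. The
  face contains a non-vertex, so it is an edge, and the strict inequality on the domain keeps it in
  the boundary.\<close>

lemma boundary_point_edge:
  assumes K: "K \<in> \<T>" and p: "p \<in> K" "p \<notin> \<Omega>" "\<not> p extreme_point_of K"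
  obtains E where "E \<in> edges \<T>" "boundary_edge \<Omega> E" "elem1 \<T> nrm E = K"
proof -
  have pc: "p \<in> closure \<Omega>" using element_subset[OF K] p by blast
  have ri: "rel_interior (closure \<Omega>) = \<Omega>"
    using rel_interior_nonempty_interior[of "closure \<Omega>"] domain_props(1) interior_closure_domain by simp
  obtain a where a: "a \<noteq> 0" "\<And>y. y \<in> closure \<Omega> \<Longrightarrow> a \<bullet> p \<le> a \<bullet> y"
      "\<And>y. y \<in> \<Omega> \<Longrightarrow> a \<bullet> p < a \<bullet> y"
    using supporting_hyperplane_rel_boundary[of "closure \<Omega>" p] pc p(2) convex_closure[OF domain_props(4)]
    unfolding ri by metis
  define E where "E = K \<inter> {y. a \<bullet> y = a \<bullet> p}"
  have "aff_dim E \<le> aff_dim {y. a \<bullet> y = a \<bullet> p}"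
    by (rule aff_dim_subset) (simp add: E_def)
  then have "aff_dim E \<le> 1" using a(1) by simp
  moreover have "E face_of K"
    unfolding E_def using element_convex[OF K] a(2) element_subset[OF K]
    by (intro face_of_Int_supporting_hyperplane_ge) auto
  ultimately have E: "E edge_of K"
    using face_is_edge[of E K p] p by (simp add: E_def)
  have b: "boundary_edge \<Omega> E"
  proof
    fix x assume "x \<in> E"
    then have "x \<in> closure \<Omega>" "a \<bullet> x = a \<bullet> p" using element_subset[OF K] by (auto simp: E_def)
    moreover have "x \<notin> \<Omega>" using a(3)[of x] \<open>a \<bullet> x = a \<bullet> p\<close> by auto
    ultimately show "x \<in> frontier \<Omega>" using domain_props(2) by (simp add: frontier_def interior_open)
  qed
  then show ?thesis using that[OF element_edges[OF K E] b elem1_boundary_edge[OF K E b]] by blast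
qed

text \<open>Both choice operators need a candidate, so an interior edge must have a second element.
  A relative interior point of \<open>E\<close> inside the domain is a limit of points outside
  \<open>K\<close>; these are covered by the closed union of the other elements, which therefore
  contains the limit.\<close>

lemma interior_edge_elements:
  assumes E: "E \<in> edges \<T>" and nb: "\<not> boundary_edge \<Omega> E"
  shows "elem1 \<T> nrm E \<in> \<T>" "elem2 \<T> nrm E \<in> \<T>"
proof -
  obtain K where K: "K \<in> \<T>" and EK: "E edge_of K" using E by (auto simp: edges_def)
  have fE: "E face_of K" "aff_dim E = 1" using EK by (auto simp: edge_of_def)
  have cE: "convex E" using fE(1) by (rule face_of_imp_convex)
  obtain x where "x \<in> E" "x \<notin> frontier \<Omega>" using nb by blast
  moreover have "x \<in> closure \<Omega>" using \<open>x \<in> E\<close> fE face_of_imp_subset element_subset[OF K] by blast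
  ultimately have "x \<in> \<Omega>" using domain_props(2) by (simp add: frontier_def interior_open)
  moreover have "x \<in> closure (rel_interior E)"
    unfolding convex_closure_rel_interior[OF cE] using \<open>x \<in> E\<close> closure_subset by blast
  ultimately have "\<Omega> \<inter> rel_interior E \<noteq> {}"
    using open_Int_closure_eq_empty[OF domain_props(2), of "rel_interior E"] by blast
  then obtain p where p: "p \<in> \<Omega>" "p \<in> rel_interior E" by blast
  have EsK: "E \<subseteq> K" using fE(1) by (rule face_of_imp_subset)
  have pE: "p \<in> E" "p \<in> K" using p(2) rel_interior_subset[of E] EsK by auto
  \<comment> \<open>An extreme point is a face, and a face meeting the relative interior of
    \<open>E\<close> contains all of \<open>E\<close>.\<close>
  have nx: "\<not> p extreme_point_of K"
  proof
    assume "p extreme_point_of K"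
    then have "{p} face_of K" by (simp add: face_of_singleton)
    then have "E \<subseteq> {p}"
      using subset_of_face_of[of "{p}" K E] p(2) EsK by simp
    then have "aff_dim E \<le> aff_dim {p}" by (rule aff_dim_subset)
    then show False using fE by simp
  qed
  have "E \<noteq> K" using fE(2) element_dim[OF K] by auto
  then have "p \<notin> interior K" using face_of_disjoint_interior[OF fE(1)] pE by blast
  then have "p \<in> \<Omega> \<inter> closure (- K)" using p by (simp add: closure_complement)
  then have "p \<in> closure (\<Omega> \<inter> - K)" using open_Int_closure_subset[OF domain_props(2)] by blast
  moreover have "\<Omega> \<inter> - K \<subseteq> \<Union>(\<T> - {K})"
    using closure_subset[of \<Omega>] unfolding Union_elements[symmetric] by blast
  moreover have "closed (\<Union>(\<T> - {K}))" using finite_elements element_closed by (intro closed_Union) auto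
  ultimately have "p \<in> \<Union>(\<T> - {K})" using closure_minimal[of "\<Omega> \<inter> - K"] by blast
  then obtain K' where K': "K' \<in> \<T>" "K \<noteq> K'" "p \<in> K \<inter> K'" using pE by blast
  note n = interior_point_neighbours[OF K K' p(1) nx]
  \<comment> \<open>The shared face contains \<open>E\<close> as a face of equal dimension, so it is
    \<open>E\<close> itself.\<close>
  have "E \<subseteq> K \<inter> K'"
    using subset_of_face_of[OF Int_face_of[OF K K'(1)] EsK] p(2) K'(3) by blast
  then have "E face_of K \<inter> K'"
    using face_of_face[OF Int_face_of[OF K K'(1)]] fE(1) by simp
  moreover have "aff_dim (K \<inter> K') = aff_dim E" using n(1) fE(2) by (simp add: edge_of_def)
  moreover have "convex (K \<inter> K')" using element_convex K K'(1) by (intro convex_Int)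
  ultimately have "E = K \<inter> K'" using face_of_aff_dim_lt[of "K \<inter> K'" E] by fastforce
  then have "{elem1 \<T> nrm E, elem2 \<T> nrm E} = {K, K'}" using n(3) by simp
  then show "elem1 \<T> nrm E \<in> \<T>" "elem2 \<T> nrm E \<in> \<T>"
    using K K'(1) by (metis insertE insertI1 insert_commute singletonD)+
qed

lemma elem1_mem: "E \<in> edges \<T> \<Longrightarrow> elem1 \<T> nrm E \<in> \<T>"
  using interior_edge_elements(1)[of E] elem1_boundary_edge[of _ E] by (auto simp: edges_def)

text \<open>The plane stays connected when the finitely many vertices are removed, while away from the
  vertices the elements with a nonzero constant are separated from everything else.\<close>

lemma piecewise_constant_zero:
  fixes c :: "pt set \<Rightarrow> complex"
  assumes bdry: "\<And>E. E \<in> edges \<T> \<Longrightarrow> boundary_edge \<Omega> E \<Longrightarrow> c (elem1 \<T> nrm E) = 0"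
    and int: "\<And>E. E \<in> edges \<T> \<Longrightarrow> \<not> boundary_edge \<Omega> E \<Longrightarrow> c (elem1 \<T> nrm E) = c (elem2 \<T> nrm E)"
    and K: "K \<in> \<T>"
  shows "c K = 0"
proof (rule ccontr)
  assume cK: "c K \<noteq> 0"
  define W where "W = (\<Union>K\<in>\<T>. {p. p extreme_point_of K})"
  have "finite {p. p extreme_point_of K}" if "K \<in> \<T>" for K
    using finite_polyhedron_extreme_points simplex_imp_polyhedron element_simplex that by blast
  then have finW: "finite W" using finite_elements by (simp add: W_def)
  have conn: "connected (- W)"
    by (intro path_connected_imp_connected path_connected_complement_countable)
       (use finW in \<open>auto simp: countable_finite\<close>)
  \<comment> \<open>The exterior counts as a region with value 0; this is how boundary edges enter
    the same separation argument as interior ones.\<close>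
  define A B where "A = - \<Omega> \<union> \<Union>{K \<in> \<T>. c K = 0}" and "B = \<Union>{K \<in> \<T>. c K \<noteq> 0}"
  have clB: "closed B" unfolding B_def using finite_elements element_closed by (intro closed_Union) auto
  have clA: "closed A" unfolding A_def
    using finite_elements element_closed domain_props(2) by (intro closed_Un closed_Union) auto
  have cover: "- W \<subseteq> A \<union> B"
    using Union_elements closure_subset[of \<Omega>] by (fastforce simp: A_def B_def)
  have disj: "A \<inter> B \<inter> - W = {}"
  proof (rule ccontr)
    assume "\<not> ?thesis"
    then obtain p L where L: "p \<in> A" "p \<notin> W" "L \<in> \<T>" "c L \<noteq> 0" "p \<in> L"
      by (auto simp: B_def)
    have nx: "\<not> p extreme_point_of L" using L by (auto simp: W_def)
    show False
    proof (cases "p \<in> \<Omega>")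
      case False
      then show False using boundary_point_edge[OF L(3,5) False nx] bdry L(4) by metis
    next
      case True
      then obtain L' where L': "L' \<in> \<T>" "c L' = 0" "p \<in> L'" using L by (auto simp: A_def)
      then have "L \<noteq> L'" "p \<in> L \<inter> L'" using L by auto
      note nb = interior_point_neighbours[OF L(3) L'(1) this True nx]
      have "c (elem1 \<T> nrm (L \<inter> L')) = c (elem2 \<T> nrm (L \<inter> L'))"
        using int[OF element_edges[OF L(3) nb(1)] nb(2)] .
      then show False using nb(3) L L' by (metis doubleton_eq_iff)
    qed
  qed
  \<comment> \<open>Both closed sets survive the removal of the vertices because each contains an
    infinite set.\<close>
  have "infinite (- \<Omega>)"
  proof
    assume "finite (- \<Omega>)"
    then have "bounded (\<Omega> \<union> - \<Omega>)" using domain_props(3) finite_imp_bounded bounded_Un by blast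
    then show False by (simp only: Compl_partition not_bounded_UNIV)
  qed
  then have "- \<Omega> - W \<noteq> {}" using Diff_infinite_finite[OF finW, of "- \<Omega>"] by force
  then have "A \<inter> - W \<noteq> {}" by (auto simp: A_def)
  moreover have "infinite K"
    using element_interior[OF K] by (meson finite_subset interior_subset finite_imp_not_open open_interior)
  then have "K - W \<noteq> {}" using Diff_infinite_finite[OF finW, of K] by force
  then have "B \<inter> - W \<noteq> {}" using K cK by (auto simp: B_def)
  ultimately show False
    using conn clA clB cover disj unfolding connected_closed by blast
qed
end

section \<open>Integrals\<close>

lemma integrable_continuous_compact:
  fixes f :: "pt \<Rightarrow> 'b::euclidean_space"
  assumes "compact K" "continuous_on K f"
  shows "set_integrable lebesgue K f"
proof -
  have "integrable lborel (\<lambda>x. indicator K x *\<^sub>R f x)"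
    using borel_integrable_compact[OF assms] by (simp add: indicator_scaleR_eq_if)
  then show ?thesis
    unfolding set_integrable_def
    by (subst integrable_completion[OF borel_measurable_integrable]) assumption+
qed

lemma continuous_linepath:
  "continuous_on UNIV f \<Longrightarrow> continuous_on {0..1} (\<lambda>t. f (linepath a b t))"
  by (rule continuous_on_compose2[of UNIV f]) (auto intro: continuous_on_linepath)

lemma edge_integral_add:
  fixes f g :: "pt \<Rightarrow> 'b::euclidean_space"
  assumes "continuous_on UNIV f" "continuous_on UNIV g"
  shows "edge_integral E (\<lambda>x. f x + g x) = edge_integral E f + edge_integral E g"
  using assms
  by (auto simp: edge_integral_def Let_def split_beta integral_add integrable_continuous_interval
      continuous_linepath scaleR_add_right)

lemma edge_integral_cmult:
  fixes f :: cfun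
  shows "edge_integral E (\<lambda>x. c * f x) = c * edge_integral E f"
  by (auto simp: edge_integral_def Let_def split_beta)

lemma edge_integral_cnj:
  fixes f :: cfun
  shows "edge_integral E (\<lambda>x. cnj (f x)) = cnj (edge_integral E f)"
  by (auto simp: edge_integral_def Let_def split_beta integral_cnj)

text \<open>The arc length integral uses a chosen pair of endpoints. A pair exists because a compact
  convex set of dimension 1 is a segment, and its endpoints differ, so the length factor is not
  0.\<close>

lemma edge_segment:
  assumes "E edge_of K" "compact K" "convex K"
  obtains a b where "(SOME (a, b). E = closed_segment a b) = (a, b)" "E = closed_segment a b" "a \<noteq> b"
proof -
  have E: "E face_of K" "aff_dim E = 1" using assms(1) by (auto simp: edge_of_def)
  have "compact E" "convex E"
    using face_of_imp_compact[OF assms(3,2) E(1)] face_of_imp_convex[OF E(1)] by auto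
  moreover have "collinear E" using E by (simp add: collinear_aff_dim)
  moreover have "E \<noteq> {}" using E by auto
  ultimately obtain a b where "E = closed_segment a b"
    using compact_convex_collinear_segment by metis
  then have s: "case (SOME (a, b). E = closed_segment a b) of (a, b) \<Rightarrow> E = closed_segment a b"
    by (intro someI[of "\<lambda>(a, b). E = closed_segment a b" "(a, b)"]) simp
  obtain a b where ab: "(SOME (a, b). E = closed_segment a b) = (a, b)" by fastforce
  then have "E = closed_segment a b" using s by simp
  moreover from this have "a \<noteq> b" using E by auto
  ultimately show ?thesis using that ab by blast
qed

text \<open>Essential boundedness is stable under products and conjugation, so cubic terms tested
  against members of the space are integrable on a bounded domain.\<close>

definition bounded_measurable :: "pt set \<Rightarrow> cfun \<Rightarrow> bool" where
  "bounded_measurable \<Omega> f \<longleftrightarrow> set_borel_measurable lebesgue \<Omega> f \<and>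
     (\<exists>B. AE x in lebesgue. x \<in> \<Omega> \<longrightarrow> cmod (f x) \<le> B)"

lemma set_borel_measurable_mult:
  fixes f g :: cfun
  assumes "set_borel_measurable M \<Omega> f" "set_borel_measurable M \<Omega> g"
  shows "set_borel_measurable M \<Omega> (\<lambda>x. f x * g x)"
proof -
  have "(\<lambda>x. indicator \<Omega> x *\<^sub>R (f x * g x)) = (\<lambda>x. (indicator \<Omega> x *\<^sub>R f x) * (indicator \<Omega> x *\<^sub>R g x))"
    by (auto simp: fun_eq_iff indicator_def)
  then show ?thesis using assms unfolding set_borel_measurable_def by (simp only: borel_measurable_times)
qed

lemma set_borel_measurable_add:
  fixes f g :: cfun
  assumes "set_borel_measurable M \<Omega> f" "set_borel_measurable M \<Omega> g"
  shows "set_borel_measurable M \<Omega> (\<lambda>x. f x + g x)"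
  using assms by (simp add: set_borel_measurable_def scaleR_add_right)

lemma set_borel_measurable_cnj:
  assumes "set_borel_measurable M \<Omega> f"
  shows "set_borel_measurable M \<Omega> (\<lambda>x. cnj (f x))"
proof -
  have "cnj \<in> borel_measurable borel"
    by (intro borel_measurable_continuous_onI continuous_intros)
  then have "(\<lambda>x. cnj (indicator \<Omega> x *\<^sub>R f x)) \<in> borel_measurable M"
    by (rule measurable_compose[OF assms[unfolded set_borel_measurable_def]])
  then show ?thesis
    unfolding set_borel_measurable_def complex_cnj_scaleR .
qed

lemma set_borel_measurable_const:
  "\<Omega> \<in> sets M \<Longrightarrow> set_borel_measurable M \<Omega> (\<lambda>x. c :: complex)"
  by (simp add: set_borel_measurable_def)

lemma bounded_measurable_mult:
  assumes "bounded_measurable \<Omega> f" "bounded_measurable \<Omega> g"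
  shows "bounded_measurable \<Omega> (\<lambda>x. f x * g x)"
proof -
  obtain A B where "AE x in lebesgue. x \<in> \<Omega> \<longrightarrow> cmod (f x) \<le> A"
    "AE x in lebesgue. x \<in> \<Omega> \<longrightarrow> cmod (g x) \<le> B"
    using assms by (auto simp: bounded_measurable_def)
  then have "AE x in lebesgue. x \<in> \<Omega> \<longrightarrow> cmod (f x * g x) \<le> A * B"
    by eventually_elim (auto simp: norm_mult intro!: mult_mono intro: order_trans[OF norm_ge_zero])
  then show ?thesis
    using assms set_borel_measurable_mult by (auto simp: bounded_measurable_def)
qed

lemma bounded_measurable_cnj:
  "bounded_measurable \<Omega> f \<Longrightarrow> bounded_measurable \<Omega> (\<lambda>x. cnj (f x))"
  using set_borel_measurable_cnj by (auto simp: bounded_measurable_def)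

text \<open>Domination by a multiple of \<open>h\<close>. Boundedness is asked of one factor only,
  which admits the Laplacian of the initial value as the other.\<close>

lemma set_integrable_mult_bounded:
  fixes h v :: cfun
  assumes h: "set_integrable lebesgue \<Omega> h" and v: "bounded_measurable \<Omega> v"
  shows "set_integrable lebesgue \<Omega> (\<lambda>x. h x * v x)"
proof -
  obtain B where B: "AE x in lebesgue. x \<in> \<Omega> \<longrightarrow> cmod (v x) \<le> B"
    using v by (auto simp: bounded_measurable_def)
  have "integrable lebesgue (\<lambda>x. B *\<^sub>R (indicator \<Omega> x *\<^sub>R h x))"
    by (rule integrable_scaleR_right[OF h[unfolded set_integrable_def]])
  moreover have "set_borel_measurable lebesgue \<Omega> (\<lambda>x. h x * v x)"
    using h v by (intro set_borel_measurable_mult)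
      (auto simp: bounded_measurable_def set_integrable_def set_borel_measurable_def)
  moreover have "AE x in lebesgue. norm (indicator \<Omega> x *\<^sub>R (h x * v x)) \<le> norm (B *\<^sub>R (indicator \<Omega> x *\<^sub>R h x))"
    using B
  proof eventually_elim
    case (elim x)
    then show ?case
      using mult_right_mono[of "cmod (v x)" "\<bar>B\<bar>" "cmod (h x)"]
      by (auto simp: indicator_def norm_mult mult.commute)
  qed
  ultimately show ?thesis
    unfolding set_integrable_def set_borel_measurable_def by (rule Bochner_Integration.integrable_bound)
qed

lemma bounded_measurable_integrable:
  assumes "bounded \<Omega>" "\<Omega> \<in> sets lebesgue" and v: "bounded_measurable \<Omega> v"
  shows "set_integrable lebesgue \<Omega> v"
proof -
  have "set_integrable lebesgue \<Omega> (\<lambda>x. 1 :: complex)"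
  proof -
    have "\<Omega> \<in> lmeasurable" using assms(1,2) by (rule bounded_set_imp_lmeasurable)
    then have "integrable lebesgue (indicat_real \<Omega>)"
      by (intro integrable_real_indicator) (auto simp: fmeasurable_def)
    from integrable_scaleR_left[OF this] show ?thesis unfolding set_integrable_def .
  qed
  from set_integrable_mult_bounded[OF this v] show ?thesis by simp
qed

lemma l2_inner_add:
  assumes "set_integrable lebesgue \<Omega> f" "set_integrable lebesgue \<Omega> g" "bounded_measurable \<Omega> v"
  shows "l2_inner \<Omega> (\<lambda>x. f x + g x) v = l2_inner \<Omega> f v + l2_inner \<Omega> g v"
  using assms set_integrable_mult_bounded[OF _ bounded_measurable_cnj]
  by (simp add: l2_inner_def distrib_right set_integral_add)

lemma l2_inner_cmult: "l2_inner \<Omega> (\<lambda>x. c * f x) v = c * l2_inner \<Omega> f v"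
  by (simp add: l2_inner_def mult.assoc)

lemma l2_inner_add_right:
  assumes "set_integrable lebesgue \<Omega> f" "bounded_measurable \<Omega> u" "bounded_measurable \<Omega> v"
  shows "l2_inner \<Omega> f (\<lambda>x. u x + v x) = l2_inner \<Omega> f u + l2_inner \<Omega> f v"
  using assms set_integrable_mult_bounded[OF _ bounded_measurable_cnj]
  by (simp add: l2_inner_def distrib_left set_integral_add)

lemma l2_inner_cmult_right: "l2_inner \<Omega> f (\<lambda>x. c * v x) = cnj c * l2_inner \<Omega> f v"
  by (simp add: l2_inner_def mult.left_commute[of _ "cnj c"])

lemma l2_inner_cong_AE:
  assumes "AE x in lebesgue. x \<in> \<Omega> \<longrightarrow> u x = u' x" "AE x in lebesgue. x \<in> \<Omega> \<longrightarrow> v x = v' x"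
    and "set_borel_measurable lebesgue \<Omega> u" "set_borel_measurable lebesgue \<Omega> u'"
    and "set_borel_measurable lebesgue \<Omega> v" "set_borel_measurable lebesgue \<Omega> v'"
  shows "l2_inner \<Omega> u v = l2_inner \<Omega> u' v'"
  unfolding l2_inner_def set_lebesgue_integral_def
proof (rule integral_cong_AE)
  show "AE x in lebesgue. indicator \<Omega> x *\<^sub>R (u x * cnj (v x)) = indicator \<Omega> x *\<^sub>R (u' x * cnj (v' x))"
    using assms(1,2) by eventually_elim (auto simp: indicator_def)
qed (use assms set_borel_measurable_mult[OF _ set_borel_measurable_cnj] in
    \<open>auto simp: set_borel_measurable_def\<close>)

section \<open>The discontinuous Galerkin form\<close>

context dg_mesh
begin

lemma domain_measurable: "\<Omega> \<in> sets lebesgue"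
  using domain_props(2) by simp

lemma domain_covered: "x \<in> \<Omega> \<Longrightarrow> \<exists>K\<in>\<T>. x \<in> K"
  using Union_elements closure_subset[of \<Omega>] by blast

text \<open>Each polynomial is bounded on its compact element; the sum of these finitely many bounds
  is a common one.\<close>

lemma piecewise_bounded_measurable:
  assumes "set_borel_measurable lebesgue \<Omega> v"
    and p: "\<And>K. K \<in> \<T> \<Longrightarrow> \<exists>p\<in>polys k. AE x in lebesgue. x \<in> K \<longrightarrow> v x = p x"
  shows "bounded_measurable \<Omega> v"
proof -
  have "\<exists>B. AE x in lebesgue. x \<in> K \<longrightarrow> cmod (v x) \<le> B" if K: "K \<in> \<T>" for K
  proof -
    obtain p where p: "p \<in> polys k" "AE x in lebesgue. x \<in> K \<longrightarrow> v x = p x"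
      using p[OF K] by blast
    have "bounded (p ` K)"
      using compact_continuous_image[OF cont_diff_continuous[OF polys_cont_diff[OF p(1)]] element_compact[OF K]]
      by (rule compact_imp_bounded)
    then obtain B where "\<And>x. x \<in> K \<Longrightarrow> cmod (p x) \<le> B" by (auto simp: bounded_iff)
    then have "AE x in lebesgue. x \<in> K \<longrightarrow> cmod (v x) \<le> B"
      using p(2) by (auto elim!: eventually_mono)
    then show ?thesis by blast
  qed
  then obtain B where B: "\<And>K. K \<in> \<T> \<Longrightarrow> AE x in lebesgue. x \<in> K \<longrightarrow> cmod (v x) \<le> B K"
    by metis
  have "AE x in lebesgue. \<forall>K\<in>\<T>. x \<in> K \<longrightarrow> cmod (v x) \<le> B K"
    using finite_elements B by (intro AE_finite_allI)
  then have "AE x in lebesgue. x \<in> \<Omega> \<longrightarrow> cmod (v x) \<le> (\<Sum>K\<in>\<T>. \<bar>B K\<bar>)"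
  proof eventually_elim
    case (elim x)
    show ?case
    proof
      assume "x \<in> \<Omega>"
      then obtain K where K: "K \<in> \<T>" "x \<in> K" using domain_covered by blast
      then have "cmod (v x) \<le> \<bar>B K\<bar>" using elim by fastforce
      also have "\<dots> \<le> (\<Sum>K\<in>\<T>. \<bar>B K\<bar>)"
        using finite_elements K by (intro member_le_sum) auto
      finally show "cmod (v x) \<le> (\<Sum>K\<in>\<T>. \<bar>B K\<bar>)" .
    qed
  qed
  then show ?thesis using assms(1) by (auto simp: bounded_measurable_def)
qed

lemma bounded_measurable_square_integrable:
  assumes "bounded_measurable \<Omega> v"
  shows "v \<in> square_integrable \<Omega>"
proof -
  have "set_integrable lebesgue \<Omega> (\<lambda>x. v x * cnj (v x))"
    by (intro bounded_measurable_integrable domain_props domain_measurable bounded_measurable_mult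
        bounded_measurable_cnj assms)
  then have "integrable lebesgue (\<lambda>x. Re (indicator \<Omega> x *\<^sub>R (v x * cnj (v x))))"
    unfolding set_integrable_def by (rule integrable_Re)
  moreover have "Re (indicator \<Omega> x *\<^sub>R (v x * cnj (v x))) = indicator \<Omega> x *\<^sub>R (cmod (v x))\<^sup>2" for x
    unfolding complex_norm_square[symmetric] of_real_power[symmetric]
    by (simp only: scaleR_complex.sel Re_complex_of_real real_scaleR_def)
  ultimately show ?thesis
    using assms unfolding square_integrable_def bounded_measurable_def set_integrable_def
    by (simp only: mem_Collect_eq)
qed

text \<open>Square integrability is a consequence here: a measurable piecewise polynomial on
  finitely many compact elements is essentially bounded, and the domain is bounded.\<close>

lemma dg_spaceI:
  assumes "set_borel_measurable lebesgue \<Omega> v"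
    and "\<And>K. K \<in> \<T> \<Longrightarrow> \<exists>p\<in>polys k. AE x in lebesgue. x \<in> K \<longrightarrow> v x = p x"
  shows "v \<in> dg_space \<Omega> \<T> k"
  using piecewise_bounded_measurable[of v k] bounded_measurable_square_integrable assms
  by (simp add: dg_space_def)

lemma dg_space_bounded_measurable: "v \<in> dg_space \<Omega> \<T> k \<Longrightarrow> bounded_measurable \<Omega> v"
  by (rule piecewise_bounded_measurable[of v k]) (auto simp: dg_space_def square_integrable_def)

lemma dg_space_measurable: "v \<in> dg_space \<Omega> \<T> k \<Longrightarrow> set_borel_measurable lebesgue \<Omega> v"
  using dg_space_bounded_measurable by (auto simp: bounded_measurable_def)

lemma dg_space_integrable: "v \<in> dg_space \<Omega> \<T> k \<Longrightarrow> set_integrable lebesgue \<Omega> v"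
  using bounded_measurable_integrable domain_props(3) domain_measurable dg_space_bounded_measurable by blast

lemma dg_space_restr:
  assumes "v \<in> dg_space \<Omega> \<T> k" "K \<in> \<T>"
  shows "restr v K \<in> polys k" "AE x in lebesgue. x \<in> K \<longrightarrow> v x = restr v K x"
proof -
  obtain p where p: "p \<in> polys k" "AE x in lebesgue. x \<in> K \<longrightarrow> v x = p x"
    using assms by (auto simp: dg_space_def)
  have "restr v K = p" using restr_eq[OF p(1) element_interior[OF assms(2)] p(2)] .
  then show "restr v K \<in> polys k" "AE x in lebesgue. x \<in> K \<longrightarrow> v x = restr v K x" using p by simp_all
qed

lemma restr_cont_diff: "v \<in> dg_space \<Omega> \<T> k \<Longrightarrow> K \<in> \<T> \<Longrightarrow> cont_diff (restr v K)"
  using dg_space_restr(1) polys_cont_diff by blast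

lemma AE_restr_add:
  assumes "u \<in> dg_space \<Omega> \<T> k" "v \<in> dg_space \<Omega> \<T> k" "K \<in> \<T>"
  shows "AE x in lebesgue. x \<in> K \<longrightarrow> u x + v x = restr u K x + restr v K x"
  using dg_space_restr(2)[OF assms(1,3)] dg_space_restr(2)[OF assms(2,3)]
  by eventually_elim auto

lemma AE_restr_cmult:
  assumes "v \<in> dg_space \<Omega> \<T> k" "K \<in> \<T>"
  shows "AE x in lebesgue. x \<in> K \<longrightarrow> c * v x = c * restr v K x"
  using dg_space_restr(2)[OF assms] by eventually_elim auto

lemma dg_space_add:
  assumes "u \<in> dg_space \<Omega> \<T> k" "v \<in> dg_space \<Omega> \<T> k"
  shows "(\<lambda>x. u x + v x) \<in> dg_space \<Omega> \<T> k"
proof (rule dg_spaceI)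
  show "\<exists>p\<in>polys k. AE x in lebesgue. x \<in> K \<longrightarrow> u x + v x = p x" if K: "K \<in> \<T>" for K
    using AE_restr_add[OF assms K] polys_add[OF dg_space_restr(1)[OF assms(1) K] dg_space_restr(1)[OF assms(2) K]]
    by (intro bexI[of _ "\<lambda>x. restr u K x + restr v K x"])
qed (intro set_borel_measurable_add dg_space_measurable[OF assms(1)] dg_space_measurable[OF assms(2)])

lemma dg_space_cmult:
  assumes "v \<in> dg_space \<Omega> \<T> k"
  shows "(\<lambda>x. c * v x) \<in> dg_space \<Omega> \<T> k"
proof (rule dg_spaceI)
  show "\<exists>p\<in>polys k. AE x in lebesgue. x \<in> K \<longrightarrow> c * v x = p x" if K: "K \<in> \<T>" for K
    using AE_restr_cmult[OF assms K, of c] polys_cmult[OF dg_space_restr(1)[OF assms K], of c]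
    by (intro bexI[of _ "\<lambda>x. c * restr v K x"])
qed (intro set_borel_measurable_mult set_borel_measurable_const domain_measurable dg_space_measurable[OF assms])

lemma restr_add:
  assumes "u \<in> dg_space \<Omega> \<T> k" "v \<in> dg_space \<Omega> \<T> k" "K \<in> \<T>"
  shows "restr (\<lambda>x. u x + v x) K = (\<lambda>x. restr u K x + restr v K x)"
  using restr_eq[OF polys_add[OF dg_space_restr(1) dg_space_restr(1)] element_interior AE_restr_add] assms
  by blast

lemma restr_cmult:
  assumes "v \<in> dg_space \<Omega> \<T> k" "K \<in> \<T>"
  shows "restr (\<lambda>x. c * v x) K = (\<lambda>x. c * restr v K x)"
  using restr_eq[OF polys_cmult[OF dg_space_restr(1)] element_interior AE_restr_cmult] assms
  by blast

lemma partial_restr_add: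
  assumes "u \<in> dg_space \<Omega> \<T> k" "v \<in> dg_space \<Omega> \<T> k" "K \<in> \<T>"
  shows "partial i (restr (\<lambda>x. u x + v x) K) x = partial i (restr u K) x + partial i (restr v K) x"
  unfolding restr_add[OF assms]
  using assms by (intro partial_add cont_diff_differentiable restr_cont_diff)

lemma partial_restr_cmult:
  assumes "v \<in> dg_space \<Omega> \<T> k" "K \<in> \<T>"
  shows "partial i (restr (\<lambda>x. c * v x) K) x = c * partial i (restr v K) x"
  unfolding restr_cmult[OF assms]
  using assms by (intro partial_cmult cont_diff_differentiable restr_cont_diff)

section \<open>Linearity and continuity of jumps and averages\<close>

lemma avg_normal_deriv_eq:
  "avg_normal_deriv \<Omega> \<T> nrm v E x = (\<Sum>i\<in>UNIV.
     (if boundary_edge \<Omega> E then partial i (restr v (elem1 \<T> nrm E)) x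
      else (1/2) * (partial i (restr v (elem1 \<T> nrm E)) x + partial i (restr v (elem2 \<T> nrm E)) x))
     * complex_of_real (nrm E $ i))"
  unfolding avg_normal_deriv_def avg_grad_def grad_def
  by (intro sum.cong refl) (simp add: scaleR_conv_of_real[where 'a = complex])

lemma jump_add:
  assumes "u \<in> dg_space \<Omega> \<T> k" "v \<in> dg_space \<Omega> \<T> k" "E \<in> edges \<T>"
  shows "jump \<Omega> \<T> nrm (\<lambda>x. u x + v x) E x = jump \<Omega> \<T> nrm u E x + jump \<Omega> \<T> nrm v E x"
  using assms elem1_mem interior_edge_elements(2) by (auto simp: jump_def restr_add)

lemma jump_cmult:
  assumes "v \<in> dg_space \<Omega> \<T> k" "E \<in> edges \<T>"
  shows "jump \<Omega> \<T> nrm (\<lambda>x. c * v x) E x = c * jump \<Omega> \<T> nrm v E x"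
  using assms elem1_mem interior_edge_elements(2)
  by (auto simp: jump_def restr_cmult right_diff_distrib)

lemma avg_normal_deriv_add:
  assumes "u \<in> dg_space \<Omega> \<T> k" "v \<in> dg_space \<Omega> \<T> k" "E \<in> edges \<T>"
  shows "avg_normal_deriv \<Omega> \<T> nrm (\<lambda>x. u x + v x) E x =
    avg_normal_deriv \<Omega> \<T> nrm u E x + avg_normal_deriv \<Omega> \<T> nrm v E x"
  using assms elem1_mem interior_edge_elements(2)
  by (auto simp: avg_normal_deriv_eq partial_restr_add sum.distrib[symmetric] algebra_simps
      add_divide_distrib intro!: sum.cong)

lemma avg_normal_deriv_cmult:
  assumes "v \<in> dg_space \<Omega> \<T> k" "E \<in> edges \<T>"
  shows "avg_normal_deriv \<Omega> \<T> nrm (\<lambda>x. c * v x) E x = c * avg_normal_deriv \<Omega> \<T> nrm v E x"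
  using assms elem1_mem interior_edge_elements(2)
  by (auto simp: avg_normal_deriv_eq partial_restr_cmult sum_distrib_left algebra_simps
      intro!: sum.cong)

lemma continuous_jump:
  assumes "v \<in> dg_space \<Omega> \<T> k" "E \<in> edges \<T>"
  shows "continuous_on A (jump \<Omega> \<T> nrm v E)"
proof (cases "boundary_edge \<Omega> E")
  case True
  then have "jump \<Omega> \<T> nrm v E = restr v (elem1 \<T> nrm E)" by (simp add: jump_def fun_eq_iff)
  then show ?thesis using assms elem1_mem cont_diff_continuous restr_cont_diff by metis
next
  case False
  then have "jump \<Omega> \<T> nrm v E = (\<lambda>x. restr v (elem1 \<T> nrm E) x - restr v (elem2 \<T> nrm E) x)"
    by (simp add: jump_def fun_eq_iff)
  then show ?thesis
    using assms interior_edge_elements[OF assms(2) False]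
    by (simp only:) (rule continuous_on_diff cont_diff_continuous restr_cont_diff | assumption)+
qed

lemma continuous_avg_normal_deriv:
  assumes "v \<in> dg_space \<Omega> \<T> k" "E \<in> edges \<T>"
  shows "continuous_on A (avg_normal_deriv \<Omega> \<T> nrm v E)"
proof (cases "boundary_edge \<Omega> E")
  case True
  then show ?thesis
    using assms elem1_mem unfolding avg_normal_deriv_eq[abs_def]
    by (auto intro!: continuous_intros cont_diff_continuous_partial restr_cont_diff)
next
  case False
  then show ?thesis
    using assms interior_edge_elements[OF assms(2) False] unfolding avg_normal_deriv_eq[abs_def]
    by (auto intro!: continuous_intros cont_diff_continuous_partial restr_cont_diff)
qed

section \<open>Sesquilinearity and Hermitian symmetry of the form\<close>

definition vol_form :: "cfun \<Rightarrow> cfun \<Rightarrow> complex" where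
  "vol_form v w = (\<Sum>K\<in>\<T>. LINT x:K|lebesgue.
     (\<Sum>i\<in>UNIV. partial i (restr v K) x * cnj (partial i (restr w K) x)))"

definition flux_form :: "cfun \<Rightarrow> cfun \<Rightarrow> complex" where
  "flux_form v w = (\<Sum>E\<in>edges \<T>. edge_integral E
     (\<lambda>x. avg_normal_deriv \<Omega> \<T> nrm v E x * cnj (jump \<Omega> \<T> nrm w E x)))"

definition penalty_form :: "real \<Rightarrow> cfun \<Rightarrow> cfun \<Rightarrow> complex" where
  "penalty_form lam v w = (\<Sum>E\<in>edges \<T>. complex_of_real (lam / diameter E) * edge_integral E
     (\<lambda>x. jump \<Omega> \<T> nrm v E x * cnj (jump \<Omega> \<T> nrm w E x)))"

text \<open>The second edge sum is the conjugate of the first with the arguments exchanged. This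
  makes the Hermitian symmetry visible and reduces both edge sums to one form.\<close>

lemma dg_form_eq:
  "dg_form \<Omega> \<T> nrm lam v w =
     vol_form v w - flux_form v w - cnj (flux_form w v) + penalty_form lam v w"
  by (simp add: dg_form_def vol_form_def flux_form_def penalty_form_def grad_def mult.commute
      flip: edge_integral_cnj)

lemma set_lebesgue_integral_cnj: "(LINT x:A|M. cnj (f x)) = cnj (LINT x:A|M. f x)"
  by (simp add: set_lebesgue_integral_def flip: complex_cnj_scaleR)

lemma vol_form_cnj: "cnj (vol_form v w) = vol_form w v"
  by (simp add: vol_form_def mult.commute flip: set_lebesgue_integral_cnj)

lemma penalty_form_cnj: "cnj (penalty_form lam v w) = penalty_form lam w v"
  by (simp add: penalty_form_def mult.commute flip: edge_integral_cnj)

lemma dg_form_cnj: "dg_form \<Omega> \<T> nrm lam w v = cnj (dg_form \<Omega> \<T> nrm lam v w)"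
  by (simp add: dg_form_eq vol_form_cnj penalty_form_cnj)

lemma vol_form_add:
  assumes "u \<in> dg_space \<Omega> \<T> k" "v \<in> dg_space \<Omega> \<T> k" "w \<in> dg_space \<Omega> \<T> k"
  shows "vol_form (\<lambda>x. u x + v x) w = vol_form u w + vol_form v w"
proof -
  have int: "set_integrable lebesgue K (\<lambda>x. \<Sum>i\<in>UNIV. partial i (restr v K) x * cnj (partial i (restr w K) x))"
    if "v \<in> dg_space \<Omega> \<T> k" "K \<in> \<T>" for v K
    using that assms(3)
    by (intro integrable_continuous_compact element_compact continuous_intros
        cont_diff_continuous_partial restr_cont_diff) auto
  show ?thesis
    using assms int unfolding vol_form_def sum.distrib[symmetric]
    by (intro sum.cong refl)
      (simp add: partial_restr_add distrib_right sum.distrib set_integral_add(2))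
qed

lemma vol_form_cmult:
  assumes "v \<in> dg_space \<Omega> \<T> k"
  shows "vol_form (\<lambda>x. c * v x) w = c * vol_form v w"
  unfolding vol_form_def sum_distrib_left
  by (intro sum.cong refl)
    (simp add: partial_restr_cmult[OF assms] mult.assoc flip: sum_distrib_left)

lemma flux_form_add_left:
  assumes "u \<in> dg_space \<Omega> \<T> k" "v \<in> dg_space \<Omega> \<T> k" "w \<in> dg_space \<Omega> \<T> k"
  shows "flux_form (\<lambda>x. u x + v x) w = flux_form u w + flux_form v w"
  unfolding flux_form_def sum.distrib[symmetric] using assms
  by (intro sum.cong refl, subst edge_integral_add[symmetric])
    (auto simp: avg_normal_deriv_add distrib_right
      intro!: continuous_intros continuous_jump continuous_avg_normal_deriv)

lemma flux_form_add_right: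
  assumes "u \<in> dg_space \<Omega> \<T> k" "v \<in> dg_space \<Omega> \<T> k" "w \<in> dg_space \<Omega> \<T> k"
  shows "flux_form w (\<lambda>x. u x + v x) = flux_form w u + flux_form w v"
  unfolding flux_form_def sum.distrib[symmetric] using assms
  by (intro sum.cong refl, subst edge_integral_add[symmetric])
    (auto simp: jump_add distrib_left
      intro!: continuous_intros continuous_jump continuous_avg_normal_deriv)

lemma flux_form_cmult_left:
  assumes "v \<in> dg_space \<Omega> \<T> k"
  shows "flux_form (\<lambda>x. c * v x) w = c * flux_form v w"
  unfolding flux_form_def sum_distrib_left
  by (intro sum.cong refl)
    (simp add: avg_normal_deriv_cmult[OF assms] mult.assoc edge_integral_cmult)

lemma flux_form_cmult_right:
  assumes "v \<in> dg_space \<Omega> \<T> k"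
  shows "flux_form w (\<lambda>x. c * v x) = cnj c * flux_form w v"
  unfolding flux_form_def sum_distrib_left
  by (intro sum.cong refl)
    (simp add: jump_cmult[OF assms] mult.left_commute[of _ "cnj c"] edge_integral_cmult)

lemma penalty_form_add:
  assumes "u \<in> dg_space \<Omega> \<T> k" "v \<in> dg_space \<Omega> \<T> k" "w \<in> dg_space \<Omega> \<T> k"
  shows "penalty_form lam (\<lambda>x. u x + v x) w = penalty_form lam u w + penalty_form lam v w"
  unfolding penalty_form_def sum.distrib[symmetric] distrib_left[symmetric] using assms
  by (intro sum.cong refl, subst edge_integral_add[symmetric])
    (auto simp: jump_add distrib_right intro!: continuous_intros continuous_jump)

lemma penalty_form_cmult:
  assumes "v \<in> dg_space \<Omega> \<T> k"
  shows "penalty_form lam (\<lambda>x. c * v x) w = c * penalty_form lam v w"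
  unfolding penalty_form_def sum_distrib_left
  by (intro sum.cong refl) (simp add: jump_cmult[OF assms] mult.assoc edge_integral_cmult)

lemma dg_form_add:
  assumes "u \<in> dg_space \<Omega> \<T> k" "v \<in> dg_space \<Omega> \<T> k" "w \<in> dg_space \<Omega> \<T> k"
  shows "dg_form \<Omega> \<T> nrm lam (\<lambda>x. u x + v x) w = dg_form \<Omega> \<T> nrm lam u w + dg_form \<Omega> \<T> nrm lam v w"
  using assms
  by (simp add: dg_form_eq vol_form_add flux_form_add_left flux_form_add_right penalty_form_add)

lemma dg_form_cmult:
  assumes "v \<in> dg_space \<Omega> \<T> k"
  shows "dg_form \<Omega> \<T> nrm lam (\<lambda>x. c * v x) w = c * dg_form \<Omega> \<T> nrm lam v w"
  using assms
  by (simp add: dg_form_eq vol_form_cmult flux_form_cmult_left flux_form_cmult_right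
      penalty_form_cmult algebra_simps)

lemma dg_form_add_right:
  assumes "u \<in> dg_space \<Omega> \<T> k" "v \<in> dg_space \<Omega> \<T> k" "w \<in> dg_space \<Omega> \<T> k"
  shows "dg_form \<Omega> \<T> nrm lam w (\<lambda>x. u x + v x) = dg_form \<Omega> \<T> nrm lam w u + dg_form \<Omega> \<T> nrm lam w v"
  using dg_form_add[OF assms, of lam] by (simp add: dg_form_cnj[of lam w])

lemma dg_form_cmult_right:
  assumes "v \<in> dg_space \<Omega> \<T> k"
  shows "dg_form \<Omega> \<T> nrm lam w (\<lambda>x. c * v x) = cnj c * dg_form \<Omega> \<T> nrm lam w v"
  using dg_form_cmult[OF assms, of lam c w] by (simp add: dg_form_cnj[of lam w])

text \<open>The hypothesis concerns the open domain while elements reach its frontier; the frontier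
  of a convex set is a null set.\<close>

lemma restr_cong:
  assumes "AE x in lebesgue. x \<in> \<Omega> \<longrightarrow> v x = v' x" "K \<in> \<T>"
  shows "restr v K = restr v' K"
proof (rule restr_cong_AE)
  have "frontier \<Omega> \<in> null_sets lebesgue"
    using negligible_convex_frontier[OF domain_props(4)] by (simp add: negligible_iff_null_sets)
  then have "AE x in lebesgue. x \<notin> frontier \<Omega>" by (rule AE_not_in)
  then show "AE x in lebesgue. x \<in> K \<longrightarrow> v x = v' x"
    using assms(1)
  proof eventually_elim
    case (elim x)
    then show ?case
      using element_subset[OF assms(2)] domain_props(2) by (auto simp: frontier_def interior_open)
  qed
qed

text \<open>Every term sees its arguments only through their traces on elements of the mesh.\<close>

lemma dg_form_cong:
  assumes "AE x in lebesgue. x \<in> \<Omega> \<longrightarrow> v x = v' x"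
  shows "dg_form \<Omega> \<T> nrm lam v w = dg_form \<Omega> \<T> nrm lam v' w"
    and "dg_form \<Omega> \<T> nrm lam w v = dg_form \<Omega> \<T> nrm lam w v'"
proof -
  have r: "restr v K = restr v' K" if "K \<in> \<T>" for K using restr_cong[OF assms that] .
  have j: "jump \<Omega> \<T> nrm v E x = jump \<Omega> \<T> nrm v' E x" if "E \<in> edges \<T>" for E x
    using r elem1_mem[OF that] interior_edge_elements(2)[OF that] by (simp add: jump_def)
  have a: "avg_normal_deriv \<Omega> \<T> nrm v E x = avg_normal_deriv \<Omega> \<T> nrm v' E x" if "E \<in> edges \<T>" for E x
    using r elem1_mem[OF that] interior_edge_elements(2)[OF that]
    by (cases "boundary_edge \<Omega> E") (simp_all add: avg_normal_deriv_eq)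
  have "vol_form v w = vol_form v' w" "flux_form v w = flux_form v' w" "flux_form w v = flux_form w v'"
    "penalty_form lam v w = penalty_form lam v' w"
    using r j a by (simp_all add: vol_form_def flux_form_def penalty_form_def)
  then show l: "dg_form \<Omega> \<T> nrm lam v w = dg_form \<Omega> \<T> nrm lam v' w" by (simp add: dg_form_eq)
  then show "dg_form \<Omega> \<T> nrm lam w v = dg_form \<Omega> \<T> nrm lam w v'"
    by (simp add: dg_form_cnj[of lam w])
qed
end

section \<open>Definiteness of the DG norm\<close>

text \<open>The partials give the derivative on the axis vectors only; by linearity it vanishes in
  every direction, and convexity of the set yields one constant.\<close>

lemma cont_diff_partial_zero_constant:
  assumes f: "cont_diff f" and U: "open U" "convex U" and z: "\<And>i x. x \<in> U \<Longrightarrow> partial i f x = 0"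
  obtains c where "\<And>x. x \<in> U \<Longrightarrow> f x = c"
proof -
  have "(f has_derivative (\<lambda>h. 0)) (at x within U)" if "x \<in> U" for x
  proof -
    have d: "(f has_derivative frechet_derivative f (at x)) (at x)"
      using cont_diff_differentiable[OF f] frechet_derivative_works by blast
    have lin: "linear (frechet_derivative f (at x))"
      using has_derivative_linear[OF d] .
    have "frechet_derivative f (at x) h = 0" for h
    proof -
      have "frechet_derivative f (at x) (\<Sum>i\<in>UNIV. h $ i *\<^sub>R axis i 1) = 0"
        using z[OF that] by (simp add: linear_sum[OF lin] linear_cmul[OF lin] partial_def)
      moreover have "(\<Sum>i\<in>UNIV. h $ i *\<^sub>R axis i 1) = h"
        using basis_expansion[of h] by (simp add: scalar_mult_eq_scaleR)
      ultimately show ?thesis by simp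
    qed
    then have "frechet_derivative f (at x) = (\<lambda>h. 0)" by (simp add: fun_eq_iff)
    then show ?thesis using d has_derivative_at_withinI by metis
  qed
  then obtain c where "\<And>x. x \<in> U \<Longrightarrow> f x = c"
    using has_derivative_zero_constant[OF U(2), of f] by auto
  then show ?thesis using that by blast
qed

lemma monomial_polys:
  assumes "a + b \<le> k"
  shows "(\<lambda>x. c * complex_of_real (x $ 1) ^ a * complex_of_real (x $ 2) ^ b) \<in> polys k"
proof -
  define d where "d = (\<lambda>i j. if i = a \<and> j = b then c else 0)"
  have eq: "(\<Sum>i\<le>k. \<Sum>j\<le>k - i. d i j * X ^ i * Y ^ j) = c * X ^ a * Y ^ b" for X Y :: complex
  proof -
    have "(\<Sum>j\<le>k - i. d i j * X ^ i * Y ^ j) = (if i = a then c * X ^ a * Y ^ b else 0)" for i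
    proof (cases "i = a")
      case True
      have "(\<Sum>j\<le>k - i. d i j * X ^ i * Y ^ j) = (\<Sum>j\<le>k - i. if j = b then c * X ^ a * Y ^ b else 0)"
        using True by (intro sum.cong) (auto simp: d_def)
      also have "\<dots> = c * X ^ a * Y ^ b" using assms True by simp
      finally show ?thesis using True by simp
    qed (simp add: d_def)
    then have "(\<Sum>i\<le>k. \<Sum>j\<le>k - i. d i j * X ^ i * Y ^ j) = (\<Sum>i\<le>k. if i = a then c * X ^ a * Y ^ b else 0)"
      by (intro sum.cong refl)
    also have "\<dots> = c * X ^ a * Y ^ b" using assms by simp
    finally show ?thesis .
  qed
  show ?thesis
    unfolding polys_def by (intro CollectI exI[of _ d]) (simp only: eq)
qed

lemma const_polys: "(\<lambda>x. c) \<in> polys k"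
  using monomial_polys[of 0 0 k c] by simp

context dg_mesh
begin

text \<open>Finiteness lets a vanishing sum of nonnegative terms be split: a sum over an infinite
  set is 0 by convention and says nothing about single jumps.\<close>

lemma finite_edges: "finite (edges \<T>)"
proof -
  have "finite {E. E edge_of K}" if "K \<in> \<T>" for K
    using finite_polytope_faces[OF simplex_imp_polytope[OF element_simplex[OF that]]]
    by (rule rev_finite_subset) (auto simp: edge_of_def)
  then have "finite (\<Union>K\<in>\<T>. {E. E edge_of K})" using finite_elements by blast
  moreover have "edges \<T> = (\<Union>K\<in>\<T>. {E. E edge_of K})" by (auto simp: edges_def)
  ultimately show ?thesis by simp
qed

lemma edge_segment':
  assumes "E \<in> edges \<T>"
  obtains a b where "(SOME (a, b). E = closed_segment a b) = (a, b)" "E = closed_segment a b" "a \<noteq> b"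
  using assms edge_segment element_compact element_convex unfolding edges_def by blast

lemma edge_integral_nonneg:
  fixes f :: "pt \<Rightarrow> real"
  assumes "continuous_on UNIV f" "\<And>x. f x \<ge> 0"
  shows "edge_integral E f \<ge> 0"
  using assms
  by (auto simp: edge_integral_def Let_def split_beta integrable_continuous_interval
      continuous_linepath intro!: mult_nonneg_nonneg integral_nonneg)

text \<open>The gradient vanishes almost everywhere, by continuity on the whole interior, and the
  identity theorem for polynomials carries the constant from there to the plane.\<close>

lemma grad_norm_zero_constant:
  assumes v: "v \<in> dg_space \<Omega> \<T> k" and K: "K \<in> \<T>"
    and z: "(LINT x:K|lebesgue. (norm (grad (restr v K) x))\<^sup>2) = 0"
  obtains c where "restr v K = (\<lambda>x. c)"
proof -
  note sm = restr_cont_diff[OF v K]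
  have cg: "continuous_on A (grad (restr v K))" for A
    unfolding grad_def[abs_def] by (intro continuous_intros cont_diff_continuous_partial sm)
  have "set_integrable lebesgue K (\<lambda>x. (norm (grad (restr v K) x))\<^sup>2)"
    by (intro integrable_continuous_compact element_compact K continuous_intros cg)
  then have "AE x in lebesgue. indicator K x *\<^sub>R (norm (grad (restr v K) x))\<^sup>2 = 0"
    using z integral_nonneg_eq_0_iff_AE[of lebesgue "\<lambda>x. indicator K x *\<^sub>R (norm (grad (restr v K) x))\<^sup>2"]
    by (simp add: set_integrable_def set_lebesgue_integral_def)
  then have ae: "AE x in lebesgue. x \<in> K \<longrightarrow> grad (restr v K) x = 0"
    by eventually_elim (auto simp: indicator_def)
  have "grad (restr v K) x = 0" if "x \<in> interior K" for x
    using AE_eq_imp_eq_on_interior[OF cg _ ae that] by simp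
  then have p0: "partial i (restr v K) x = 0" if "x \<in> interior K" for i x
    using that by (simp add: grad_def vec_eq_iff)
  obtain c where c: "\<And>x. x \<in> interior K \<Longrightarrow> restr v K x = c"
    using cont_diff_partial_zero_constant[OF sm open_interior convex_interior[OF element_convex[OF K]] p0]
    by blast
  obtain a where "a \<in> interior K" using element_interior[OF K] by blast
  then have "restr v K = (\<lambda>x. c)"
    using polys_eq_of_eq_on_open[OF dg_space_restr(1)[OF v K] const_polys open_interior] c by blast
  then show ?thesis using that by blast
qed

lemma dg_norm_zero:
  assumes v: "v \<in> dg_space \<Omega> \<T> k" and z: "dg_norm \<Omega> \<T> nrm v = 0"
  shows "AE x in lebesgue. x \<in> \<Omega> \<longrightarrow> v x = 0"
proof -
  have cj: "continuous_on UNIV (\<lambda>x. (cmod (jump \<Omega> \<T> nrm v E x))\<^sup>2)" if "E \<in> edges \<T>" for E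
    by (intro continuous_intros continuous_jump[OF v that])
  have n1: "(LINT x:K|lebesgue. (norm (grad (restr v K) x))\<^sup>2) \<ge> 0" for K
    by (simp add: set_lebesgue_integral_def)
  \<comment> \<open>A positive diameter allows the weight of each edge to be cancelled.\<close>
  have diam: "diameter E > 0" if mem: "E \<in> edges \<T>" for E
  proof -
    obtain a b where "(SOME (a, b). E = closed_segment a b) = (a, b)"
      and E: "E = closed_segment a b" "a \<noteq> b"
      by (rule edge_segment'[OF mem])
    have "dist a b \<le> diameter E"
      using diameter_bounded_bound[OF compact_imp_bounded[OF compact_segment[of a b]], of a b]
      by (simp add: E(1))
    then show ?thesis using E(2) zero_less_dist_iff[of a b] by linarith
  qed
  define I where "I K = (LINT x:K|lebesgue. (norm (grad (restr v K) x))\<^sup>2)" for K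
  define J where "J E = 1 / diameter E * edge_integral E (\<lambda>x. (cmod (jump \<Omega> \<T> nrm v E x))\<^sup>2)" for E
  have I: "I K \<ge> 0" for K unfolding I_def by (rule n1)
  have J: "J E \<ge> 0" if "E \<in> edges \<T>" for E
    unfolding J_def
    by (intro mult_nonneg_nonneg edge_integral_nonneg cj that) (use diam[OF that] in auto)
  have "sum I \<T> \<ge> 0" "sum J (edges \<T>) \<ge> 0"
    by (intro sum_nonneg I J; assumption)+
  moreover have "sum I \<T> + sum J (edges \<T>) = 0"
    using z unfolding dg_norm_def real_sqrt_eq_zero_cancel_iff I_def J_def .
  ultimately have s: "sum I \<T> = 0" "sum J (edges \<T>) = 0" by linarith+
  have g0: "(LINT x:K|lebesgue. (norm (grad (restr v K) x))\<^sup>2) = 0" if "K \<in> \<T>" for K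
    using sum_nonneg_0[OF finite_elements I s(1) that] unfolding I_def .
  have j0: "edge_integral E (\<lambda>x. (cmod (jump \<Omega> \<T> nrm v E x))\<^sup>2) = 0" if "E \<in> edges \<T>" for E
    using sum_nonneg_0[OF finite_edges J s(2) that] diam[OF that] unfolding J_def by simp
  have "\<exists>c. restr v K = (\<lambda>x. c)" if "K \<in> \<T>" for K
    using grad_norm_zero_constant[OF v that g0[OF that]] by blast
  then obtain c where c: "\<And>K. K \<in> \<T> \<Longrightarrow> restr v K = (\<lambda>x. c K)" by metis
  \<comment> \<open>With constant traces the jump is a single number on each edge, so the edge
    integral is its squared modulus times a positive length.\<close>
  define j where "j E = (if boundary_edge \<Omega> E then c (elem1 \<T> nrm E)
      else c (elem1 \<T> nrm E) - c (elem2 \<T> nrm E))" for E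
  have "j E = 0" if E: "E \<in> edges \<T>" for E
  proof -
    have "jump \<Omega> \<T> nrm v E x = j E" for x
      using c elem1_mem[OF E] interior_edge_elements(2)[OF E] by (simp add: jump_def j_def)
    moreover obtain a b where "(SOME (a, b). E = closed_segment a b) = (a, b)"
      "E = closed_segment a b" "a \<noteq> b"
      by (rule edge_segment'[OF E])
    ultimately show ?thesis using j0[OF E] by (simp add: edge_integral_def)
  qed
  note jz = this
  have "c K = 0" if "K \<in> \<T>" for K
  proof (rule piecewise_constant_zero[OF _ _ that])
    fix E assume "E \<in> edges \<T>" "boundary_edge \<Omega> E"
    then show "c (elem1 \<T> nrm E) = 0" using jz[of E] by (simp add: j_def)
  next
    fix E assume "E \<in> edges \<T>" "\<not> boundary_edge \<Omega> E"
    then show "c (elem1 \<T> nrm E) = c (elem2 \<T> nrm E)"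
      using jz[of E] by (simp add: j_def)
  qed
  note cz = this
  have "AE x in lebesgue. x \<in> K \<longrightarrow> v x = 0" if "K \<in> \<T>" for K
    using dg_space_restr(2)[OF v that] c[OF that] cz[OF that] by simp
  then have "AE x in lebesgue. \<forall>K\<in>\<T>. x \<in> K \<longrightarrow> v x = 0"
    using finite_elements by (intro AE_finite_allI)
  then show ?thesis
  proof eventually_elim
    case (elim x)
    then show ?case using domain_covered[of x] by auto
  qed
qed
end

section \<open>Orthonormal bases\<close>

text \<open>Coefficients are real to match the zero theorem, and for the same reason
  \<open>x\<close> is a function on all naturals, of which the first \<open>d\<close> values
  count.\<close>

definition comb :: "nat \<Rightarrow> (nat \<Rightarrow> cfun) \<Rightarrow> (nat \<Rightarrow> real) \<Rightarrow> cfun" where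
  "comb d e x = (\<lambda>p. \<Sum>i<d. complex_of_real (x i) * e i p)"

locale dg_scheme = dg_mesh +
  fixes k :: nat and lam C :: real
  assumes C_pos: "C > 0"
    and coercive: "v \<in> dg_space \<Omega> \<T> k \<Longrightarrow> C * (dg_norm \<Omega> \<T> nrm v)\<^sup>2 \<le> Re (dg_form \<Omega> \<T> nrm lam v v)"
begin

abbreviation "V \<equiv> dg_space \<Omega> \<T> k"
abbreviation "a \<equiv> dg_form \<Omega> \<T> nrm lam"

lemma zero_mem: "(\<lambda>x. 0) \<in> V"
  by (rule dg_spaceI) (auto simp: set_borel_measurable_def intro!: bexI[OF _ const_polys[of 0]])

lemma comb_mem: "(\<And>i. i < d \<Longrightarrow> e i \<in> V) \<Longrightarrow> comb d e x \<in> V"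
proof (induction d)
  case (Suc d)
  have "comb (Suc d) e x = (\<lambda>p. comb d e x p + complex_of_real (x d) * e d p)"
    by (simp add: comb_def)
  then show ?case using Suc by (simp add: dg_space_add dg_space_cmult)
qed (simp add: comb_def zero_mem)

text \<open>Homogeneity is asked for real factors only, which covers linear and antilinear
  functionals alike, and also each slot of the cubic term.\<close>

lemma comb_linear:
  assumes add: "\<And>u v. u \<in> V \<Longrightarrow> v \<in> V \<Longrightarrow> L (\<lambda>x. u x + v x) = L u + L v"
    and cmult: "\<And>c v. v \<in> V \<Longrightarrow> L (\<lambda>x. complex_of_real c * v x) = complex_of_real c * (L v :: complex)"
    and e: "\<And>i. i < d \<Longrightarrow> e i \<in> V"
  shows "L (comb d e x) = (\<Sum>i<d. complex_of_real (x i) * L (e i))"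
  using e
proof (induction d)
  case 0
  \<comment> \<open>The empty combination is the zero function, evaluated through homogeneity with
    factor 0.\<close>
  show ?case using cmult[OF zero_mem, of 0] by (simp add: comb_def)
next
  case (Suc d)
  have "comb (Suc d) e x = (\<lambda>p. comb d e x p + complex_of_real (x d) * e d p)"
    by (simp add: comb_def)
  moreover have "comb d e x \<in> V" "(\<lambda>p. complex_of_real (x d) * e d p) \<in> V" "e d \<in> V"
    using Suc.prems by (auto intro: comb_mem dg_space_cmult)
  ultimately show ?case using Suc add cmult by simp
qed

lemma form_real: "Im (a v v) = 0"
  using arg_cong[where f = Im, OF dg_form_cnj[of lam v v]] by simp

lemma form_sym: "Re (a v w) = Re (a w v)"
  using dg_form_cnj[of lam v w] by simp

lemma form_nonneg: "v \<in> V \<Longrightarrow> Re (a v v) \<ge> 0"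
  using coercive[of v] C_pos by (meson mult_nonneg_nonneg less_imp_le order_trans zero_le_power2)

lemma form_definite:
  assumes "v \<in> V" "Re (a v v) = 0"
  shows "AE x in lebesgue. x \<in> \<Omega> \<longrightarrow> v x = 0"
proof -
  have "(dg_norm \<Omega> \<T> nrm v)\<^sup>2 \<le> 0"
    using coercive[OF assms(1)] assms(2) C_pos by (simp add: mult_le_0_iff)
  then show ?thesis using dg_norm_zero[OF assms(1)] by simp
qed

text \<open>Re a_h is a real inner product modulo null functions. A function and its multiple by
  \<i> are orthogonal for it, so the number \<open>d\<close> of a spanning family is the real
  dimension.\<close>

definition orthonormal :: "nat \<Rightarrow> (nat \<Rightarrow> cfun) \<Rightarrow> bool" where
  "orthonormal d e \<longleftrightarrow> (\<forall>i<d. e i \<in> V) \<and>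
     (\<forall>i<d. \<forall>j<d. Re (a (e i) (e j)) = (if i = j then 1 else 0))"

text \<open>Pointwise equality would be too strong, since members of the space agree with their
  polynomials only almost everywhere.\<close>

definition spanned :: "nat \<Rightarrow> (nat \<Rightarrow> cfun) \<Rightarrow> cfun \<Rightarrow> bool" where
  "spanned d e v \<longleftrightarrow> (\<exists>x. AE p in lebesgue. p \<in> \<Omega> \<longrightarrow> v p = comb d e x p)"

lemma spanned_add:
  assumes "spanned d e u" "spanned d e v" shows "spanned d e (\<lambda>p. u p + v p)"
proof -
  obtain x y where "AE p in lebesgue. p \<in> \<Omega> \<longrightarrow> u p = comb d e x p"
    "AE p in lebesgue. p \<in> \<Omega> \<longrightarrow> v p = comb d e y p"
    using assms by (auto simp: spanned_def)
  then have "AE p in lebesgue. p \<in> \<Omega> \<longrightarrow> u p + v p = comb d e (\<lambda>i. x i + y i) p"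
    by eventually_elim (auto simp: comb_def distrib_right sum.distrib)
  then show ?thesis unfolding spanned_def by blast
qed

lemma spanned_cmult:
  assumes "spanned d e v" shows "spanned d e (\<lambda>p. complex_of_real c * v p)"
proof -
  obtain x where "AE p in lebesgue. p \<in> \<Omega> \<longrightarrow> v p = comb d e x p"
    using assms by (auto simp: spanned_def)
  then have "AE p in lebesgue. p \<in> \<Omega> \<longrightarrow> complex_of_real c * v p = comb d e (\<lambda>i. c * x i) p"
    by eventually_elim (auto simp: comb_def sum_distrib_left mult.assoc)
  then show ?thesis unfolding spanned_def by blast
qed

lemma spanned_sum:
  assumes "\<And>i. i \<in> A \<Longrightarrow> spanned d e (f i)"
  shows "spanned d e (\<lambda>p. \<Sum>i\<in>A. f i p)"
  using assms
proof (induction A rule: infinite_finite_induct)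
  case (insert i A)
  then show ?case using spanned_add by simp
qed (auto simp: spanned_def comb_def intro!: exI[of _ "\<lambda>i. 0"])

lemma spanned_cong:
  assumes "spanned d e v" "AE p in lebesgue. p \<in> \<Omega> \<longrightarrow> u p = v p" shows "spanned d e u"
proof -
  obtain x where "AE p in lebesgue. p \<in> \<Omega> \<longrightarrow> v p = comb d e x p"
    using assms by (auto simp: spanned_def)
  with assms(2) have "AE p in lebesgue. p \<in> \<Omega> \<longrightarrow> u p = comb d e x p"
    by eventually_elim auto
  then show ?thesis unfolding spanned_def by blast
qed

lemma form_comb_left:
  "(\<And>i. i < d \<Longrightarrow> e i \<in> V) \<Longrightarrow> w \<in> V \<Longrightarrow> a (comb d e x) w = (\<Sum>i<d. complex_of_real (x i) * a (e i) w)"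
  by (rule comb_linear[of "\<lambda>v. a v w"]) (auto simp: dg_form_add dg_form_cmult)

lemma form_comb_right:
  "(\<And>i. i < d \<Longrightarrow> e i \<in> V) \<Longrightarrow> w \<in> V \<Longrightarrow> a w (comb d e x) = (\<Sum>i<d. complex_of_real (x i) * a w (e i))"
  by (rule comb_linear[of "\<lambda>v. a w v"]) (auto simp: dg_form_add_right dg_form_cmult_right)

lemma form_comb_basis:
  assumes o: "orthonormal d e" and i: "i < d"
  shows "Re (a (comb d e x) (e i)) = x i"
proof -
  have "Re (a (comb d e x) (e i)) = (\<Sum>j<d. x j * Re (a (e j) (e i)))"
    using o i by (subst form_comb_left) (auto simp: orthonormal_def)
  also have "\<dots> = (\<Sum>j<d. if j = i then x j else 0)"
    using o i by (intro sum.cong) (auto simp: orthonormal_def)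
  also have "\<dots> = x i" using i by simp
  finally show ?thesis .
qed

lemma form_comb_self:
  assumes o: "orthonormal d e"
  shows "Re (a (comb d e x) (comb d e x)) = (\<Sum>i<d. (x i)\<^sup>2)"
proof -
  have "Re (a (comb d e x) (comb d e x)) = (\<Sum>i<d. x i * Re (a (comb d e x) (e i)))"
    using o by (subst form_comb_right) (auto simp: orthonormal_def intro!: comb_mem)
  also have "\<dots> = (\<Sum>i<d. (x i)\<^sup>2)"
    by (intro sum.cong) (auto simp: form_comb_basis[OF o] power2_eq_square)
  finally show ?thesis .
qed

text \<open>If the residual of the projection has zero energy, it is null by definiteness and
  \<open>g\<close> is already spanned; otherwise the normalized residual is appended.\<close>

lemma gram_schmidt_step:
  assumes o: "orthonormal d e" and g: "g \<in> V"
  obtains d' e' where "orthonormal d' e'" "spanned d' e' g" "\<And>v. spanned d e v \<Longrightarrow> spanned d' e' v"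
proof -
  define x where "x = (\<lambda>i. Re (a g (e i)))"
  define r where "r = (\<lambda>p. g p + complex_of_real (-1) * comb d e x p)"
  have cV: "comb d e x \<in> V" using o by (intro comb_mem) (auto simp: orthonormal_def)
  have r: "r \<in> V" unfolding r_def by (intro dg_space_add dg_space_cmult g cV)
  have orth: "Re (a r (e i)) = 0" if "i < d" for i
  proof -
    have "e i \<in> V" using o that by (simp add: orthonormal_def)
    then have "a r (e i) = a g (e i) + a (\<lambda>p. complex_of_real (-1) * comb d e x p) (e i)"
      unfolding r_def by (rule dg_form_add[OF g dg_space_cmult[OF cV]])
    then have "a r (e i) = a g (e i) - a (comb d e x) (e i)"
      unfolding dg_form_cmult[OF cV] by simp
    then show ?thesis using form_comb_basis[OF o that, of x] by (simp add: x_def)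
  qed
  show ?thesis
  proof (cases "Re (a r r) = 0")
    case True
    then have "AE p in lebesgue. p \<in> \<Omega> \<longrightarrow> g p = comb d e x p"
      using form_definite[OF r] by (simp add: r_def)
    then have "spanned d e g" unfolding spanned_def by blast
    then show ?thesis using that o by blast
  next
    case False
    define s where "s = sqrt (Re (a r r))"
    have s: "s > 0" "s\<^sup>2 = Re (a r r)" using False form_nonneg[OF r] by (auto simp: s_def)
    define e' where "e' = e(d := \<lambda>p. complex_of_real (1 / s) * r p)"
    have e'V: "e' i \<in> V" if "i < Suc d" for i
    proof (cases "i = d")
      case True
      then show ?thesis unfolding e'_def by (simp only: fun_upd_same dg_space_cmult[OF r])
    next
      case False
      then show ?thesis using that o by (simp add: e'_def orthonormal_def)
    qed
    have "Re (a (e' d) (e' d)) = 1"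
      using s r False by (simp add: e'_def dg_form_cmult dg_form_cmult_right dg_space_cmult power2_eq_square flip: of_real_divide)
    moreover have z: "Re (a (e' d) (e' i)) = 0" if "i < d" for i
      using orth[OF that] that r by (simp add: e'_def dg_form_cmult flip: of_real_divide)
    moreover have "Re (a (e' i) (e' d)) = 0" if "i < d" for i
      using z[OF that] form_sym[of "e' i" "e' d"] by simp
    moreover have "Re (a (e' i) (e' j)) = (if i = j then 1 else 0)" if "i < d" "j < d" for i j
      using that o by (auto simp: e'_def orthonormal_def)
    ultimately have o': "orthonormal (Suc d) e'"
      using e'V by (auto simp: orthonormal_def less_Suc_eq)
    have comb: "comb (Suc d) e' y = (\<lambda>p. comb d e y p + complex_of_real (y d / s) * r p)" for y
      by (simp add: comb_def e'_def fun_eq_iff)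
    \<comment> \<open>The residual was divided by \<open>s\<close>, so its coefficient in
      \<open>g\<close> is \<open>s\<close>; older combinations later get the coefficient 0.\<close>
    have "g = comb (Suc d) e' (x(d := s))"
      using s by (simp add: comb r_def fun_eq_iff) (simp add: comb_def)
    then have "spanned (Suc d) e' g" unfolding spanned_def by (intro exI[of _ "x(d := s)"]) simp
    moreover have "spanned (Suc d) e' v" if v: "spanned d e v" for v
    proof -
      obtain y where y: "AE p in lebesgue. p \<in> \<Omega> \<longrightarrow> v p = comb d e y p"
        using v by (auto simp: spanned_def)
      moreover have "comb (Suc d) e' (y(d := 0)) = comb d e y"
        by (simp add: comb fun_eq_iff) (simp add: comb_def)
      ultimately show ?thesis unfolding spanned_def by (intro exI[of _ "y(d := 0)"]) simp
    qed
    ultimately show ?thesis using that o' by blast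
  qed
qed

lemma gram_schmidt:
  assumes "finite S" "S \<subseteq> V"
  shows "\<exists>d e. orthonormal d e \<and> (\<forall>g\<in>S. spanned d e g)"
  using assms
proof (induction S)
  case empty
  then show ?case by (intro exI[of _ 0]) (simp add: orthonormal_def)
next
  case (insert g S)
  then obtain d e where de: "orthonormal d e" "\<forall>g\<in>S. spanned d e g" by auto
  obtain d' e' where "orthonormal d' e'" "spanned d' e' g" "\<And>v. spanned d e v \<Longrightarrow> spanned d' e' v"
    using gram_schmidt_step[OF de(1)] insert.prems by blast
  then show ?case using de(2) by blast
qed

section \<open>A finite family of generators\<close>

definition generator :: "pt set \<Rightarrow> nat \<Rightarrow> nat \<Rightarrow> complex \<Rightarrow> cfun" where
  "generator K i j s = (\<lambda>x. if x \<in> K then s * complex_of_real (x $ 1) ^ i * complex_of_real (x $ 2) ^ j else 0)"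

lemma AE_unique_element:
  "AE x in lebesgue. \<forall>K\<in>\<T>. \<forall>K'\<in>\<T>. K \<noteq> K' \<longrightarrow> \<not> (x \<in> K \<and> x \<in> K')"
proof (intro AE_finite_allI finite_elements)
  fix K K' assume K: "K \<in> \<T>" "K' \<in> \<T>"
  show "AE x in lebesgue. K \<noteq> K' \<longrightarrow> \<not> (x \<in> K \<and> x \<in> K')"
  proof (cases "K = K'")
    case False
    then have "K \<inter> K' \<in> null_sets lebesgue"
      using Int_negligible[OF K] by (simp add: negligible_iff_null_sets)
    from AE_not_in[OF this] show ?thesis by eventually_elim auto
  qed simp
qed

text \<open>On another element the function can be nonzero only on the intersection with
  \<open>K\<close>, a null set, so the zero polynomial represents it there.\<close>

lemma generator_mem:
  assumes K: "K \<in> \<T>" and ij: "i + j \<le> k"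
  shows "generator K i j s \<in> V"
proof (rule dg_spaceI)
  let ?m = "\<lambda>x::pt. s * complex_of_real (x $ 1) ^ i * complex_of_real (x $ 2) ^ j"
  have "?m \<in> borel_measurable lebesgue"
    using cont_diff_continuous[OF polys_cont_diff[OF monomial_polys[OF ij]], of UNIV s]
    by (simp add: borel_measurable_continuous_onI measurable_completion)
  moreover have "K \<in> sets lebesgue" using element_closed[OF K] by auto
  moreover have "(\<lambda>x. indicator \<Omega> x *\<^sub>R generator K i j s x) = (\<lambda>x. indicator (\<Omega> \<inter> K) x *\<^sub>R ?m x)"
    by (auto simp: generator_def fun_eq_iff indicator_def)
  ultimately show "set_borel_measurable lebesgue \<Omega> (generator K i j s)"
    using domain_measurable unfolding set_borel_measurable_def
    by (simp only:) (intro borel_measurable_scaleR borel_measurable_indicator sets.Int)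
next
  fix K' assume K': "K' \<in> \<T>"
  show "\<exists>p\<in>polys k. AE x in lebesgue. x \<in> K' \<longrightarrow> generator K i j s x = p x"
  proof (cases "K' = K")
    case True
    then show ?thesis
      by (intro bexI[OF _ monomial_polys[OF ij, of s]]) (simp add: generator_def)
  next
    case False
    have "AE x in lebesgue. x \<in> K' \<longrightarrow> generator K i j s x = 0"
      using AE_unique_element by eventually_elim (use K K' False in \<open>auto simp: generator_def\<close>)
    then show ?thesis by (intro bexI[OF _ const_polys[of 0]])
  qed
qed

lemma orthonormal_basis: "\<exists>d e. orthonormal d e \<and> (\<forall>v\<in>V. spanned d e v)"
proof -
  \<comment> \<open>The factors 1 and \<i> make the real span of the monomials equal to the complex
    one.\<close>
  define I where "I = \<T> \<times> (SIGMA i:{..k}. {..k - i}) \<times> {1, \<i>}"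
  define S where "S = (\<lambda>(K, (i, j), s). generator K i j s) ` I"
  have "finite I" unfolding I_def using finite_elements
    by (intro finite_cartesian_product finite_SigmaI) simp_all
  then have "finite S" unfolding S_def by (rule finite_imageI)
  moreover have "S \<subseteq> V"
  proof
    fix g assume "g \<in> S"
    then obtain K i j s where "K \<in> \<T>" "i \<le> k" "j \<le> k - i" "g = generator K i j s"
      by (auto simp: S_def I_def)
    then show "g \<in> V" using generator_mem[of K i j] by simp
  qed
  ultimately obtain d e where de: "orthonormal d e" "\<forall>g\<in>S. spanned d e g"
    using gram_schmidt by blast
  have "spanned d e v" if v: "v \<in> V" for v
  proof -
    have "\<exists>c. restr v K = (\<lambda>x. \<Sum>i\<le>k. \<Sum>j\<le>k - i. c i j * complex_of_real (x $ 1) ^ i * complex_of_real (x $ 2) ^ j)"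
      if "K \<in> \<T>" for K
      using dg_space_restr(1)[OF v that] unfolding polys_def by blast
    then have "\<forall>K. \<exists>c. K \<in> \<T> \<longrightarrow> restr v K =
        (\<lambda>x. \<Sum>i\<le>k. \<Sum>j\<le>k - i. c i j * complex_of_real (x $ 1) ^ i * complex_of_real (x $ 2) ^ j)"
      by blast
    from choice[OF this] obtain c where c: "\<And>K. K \<in> \<T> \<Longrightarrow> restr v K =
        (\<lambda>x. \<Sum>i\<le>k. \<Sum>j\<le>k - i. c K i j * complex_of_real (x $ 1) ^ i * complex_of_real (x $ 2) ^ j)"
      by blast
    have "spanned d e (generator K i j (c K i j))" if "K \<in> \<T>" "i \<le> k" "j \<le> k - i" for K i j
    proof -
      have "generator K i j s \<in> S" if "s \<in> {1, \<i>}" for s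
        unfolding S_def
        by (rule image_eqI[of _ _ "(K, (i, j), s)"]) (use that \<open>K \<in> \<T>\<close> \<open>i \<le> k\<close> \<open>j \<le> k - i\<close> in \<open>auto simp: I_def\<close>)
      then have "spanned d e (generator K i j 1)" "spanned d e (generator K i j \<i>)"
        using de(2) by simp_all
      then have "spanned d e (\<lambda>p. complex_of_real (Re (c K i j)) * generator K i j 1 p
          + complex_of_real (Im (c K i j)) * generator K i j \<i> p)"
        by (intro spanned_add spanned_cmult)
      moreover have "(\<lambda>p. complex_of_real (Re z) * generator K i j 1 p
          + complex_of_real (Im z) * generator K i j \<i> p) = generator K i j z" for z
      proof
        fix p
        have "complex_of_real (Re z) * (1 * m1 * m2) + complex_of_real (Im z) * (\<i> * m1 * m2) = z * m1 * m2" for m1 m2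
        proof -
          have "complex_of_real (Re z) * (1 * m1 * m2) + complex_of_real (Im z) * (\<i> * m1 * m2)
              = (complex_of_real (Re z) + \<i> * complex_of_real (Im z)) * (m1 * m2)"
            by (simp add: algebra_simps)
          also have "\<dots> = z * m1 * m2" unfolding complex_eq[symmetric] by (rule mult.assoc[symmetric])
          finally show ?thesis .
        qed
        then show "complex_of_real (Re z) * generator K i j 1 p
          + complex_of_real (Im z) * generator K i j \<i> p = generator K i j z p"
          by (simp add: generator_def)
      qed
      ultimately show ?thesis by (simp only:)
    qed
    then have "spanned d e (\<lambda>p. \<Sum>K\<in>\<T>. \<Sum>i\<le>k. \<Sum>j\<le>k - i. generator K i j (c K i j) p)"
      by (intro spanned_sum) simp
    moreover have "AE p in lebesgue. p \<in> \<Omega> \<longrightarrow>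
        v p = (\<Sum>K\<in>\<T>. \<Sum>i\<le>k. \<Sum>j\<le>k - i. generator K i j (c K i j) p)"
    proof -
      have "AE x in lebesgue. \<forall>K\<in>\<T>. x \<in> K \<longrightarrow> v x = restr v K x"
        using dg_space_restr(2)[OF v] by (intro AE_finite_allI finite_elements)
      with AE_unique_element show ?thesis
      proof eventually_elim
        case (elim p)
        show ?case
        proof
          assume "p \<in> \<Omega>"
          then obtain K where K: "K \<in> \<T>" "p \<in> K" using domain_covered by blast
          \<comment> \<open>Almost every point of the domain lies in exactly one element, so a
            single term of the sum over the mesh remains.\<close>
          have "(\<Sum>L\<in>\<T>. \<Sum>i\<le>k. \<Sum>j\<le>k - i. generator L i j (c L i j) p)
              = (\<Sum>L\<in>\<T>. if L = K then restr v K p else 0)"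
          proof (rule sum.cong)
            fix L assume "L \<in> \<T>"
            then have "p \<in> L \<longleftrightarrow> L = K" using elim(1) K by blast
            then show "(\<Sum>i\<le>k. \<Sum>j\<le>k - i. generator L i j (c L i j) p) = (if L = K then restr v K p else 0)"
              by (simp add: generator_def c[OF K(1)])
          qed simp
          also have "\<dots> = restr v K p" using K finite_elements by simp
          also have "\<dots> = v p" using elim(2) K by metis
          finally show "v p = (\<Sum>K\<in>\<T>. \<Sum>i\<le>k. \<Sum>j\<le>k - i. generator K i j (c K i j) p)" by simp
        qed
      qed
    qed
    ultimately show ?thesis using spanned_cong by blast
  qed
  then show ?thesis using de(1) by blast
qed
end

section \<open>Ritz projection and Crank-Nicolson steps\<close>

text \<open>On a bounded set the constant 1 is integrable, and t \<le> 1 + t^2 dominates the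
  modulus.\<close>

lemma square_integrable_integrable:
  assumes "bounded \<Omega>" "\<Omega> \<in> sets lebesgue" and f: "f \<in> square_integrable \<Omega>"
  shows "set_integrable lebesgue \<Omega> f"
proof -
  have "set_integrable lebesgue \<Omega> (\<lambda>x. 1 :: real)"
    unfolding set_integrable_def using bounded_set_imp_lmeasurable[OF assms(1,2)]
    by (simp add: lmeasurable_iff_integrable)
  then have "set_integrable lebesgue \<Omega> (\<lambda>x. 1 + (cmod (f x))\<^sup>2)"
    using f by (intro set_integral_add) (auto simp: square_integrable_def)
  note int = this[unfolded set_integrable_def]
  have bound: "norm (indicator \<Omega> x *\<^sub>R f x) \<le> norm (indicator \<Omega> x *\<^sub>R (1 + (cmod (f x))\<^sup>2))" for x
  proof -
    define c where "c = cmod (f x)"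
    have "0 \<le> (1 - c)\<^sup>2" by simp
    then have "2 * c \<le> 1 + c\<^sup>2" by (simp add: power2_diff)
    moreover have "0 \<le> c" by (simp add: c_def)
    ultimately have "c \<le> 1 + c\<^sup>2" by linarith
    also have "\<dots> = \<bar>1 + c\<^sup>2\<bar>" by (rule abs_of_nonneg[symmetric]) simp
    finally show ?thesis
      unfolding norm_scaleR real_norm_def real_scaleR_def abs_mult c_def by (rule mult_left_mono) (rule abs_ge_zero)
  qed
  have "(\<lambda>x. indicator \<Omega> x *\<^sub>R f x) \<in> borel_measurable lebesgue"
    using f unfolding square_integrable_def set_borel_measurable_def by blast
  then show ?thesis
    unfolding set_integrable_def
    by (rule Bochner_Integration.integrable_bound[OF int]) (intro AE_I2 bound)
qed

lemma l2_inner_self: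
  fixes w :: cfun
  obtains p where "l2_inner \<Omega> w w = complex_of_real p" "p \<ge> 0"
proof
  show "l2_inner \<Omega> w w = complex_of_real (LINT x:\<Omega>|lebesgue. (cmod (w x))\<^sup>2)"
    unfolding l2_inner_def set_integral_complex_of_real[symmetric]
    by (simp only: complex_norm_square)
  show "(LINT x:\<Omega>|lebesgue. (cmod (w x))\<^sup>2) \<ge> 0" by (simp add: set_lebesgue_integral_def)
qed

text \<open>The integrand is |w|^4. As the value is real, its product with \<kappa> + \<i> \<beta>
  has real part \<kappa> q.\<close>

lemma l2_inner_cubic_self:
  fixes w :: cfun
  obtains q where "l2_inner \<Omega> (\<lambda>x. w x * cnj (w x) * w x) w = complex_of_real q" "q \<ge> 0"
proof
  have "w x * cnj (w x) * w x * cnj (w x) = complex_of_real ((cmod (w x))\<^sup>2 * (cmod (w x))\<^sup>2)" for x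
    unfolding of_real_mult complex_norm_square by (simp only: of_real_power complex_norm_square mult.assoc)
  then show "l2_inner \<Omega> (\<lambda>x. w x * cnj (w x) * w x) w
      = complex_of_real (LINT x:\<Omega>|lebesgue. (cmod (w x))\<^sup>2 * (cmod (w x))\<^sup>2)"
    unfolding l2_inner_def set_integral_complex_of_real[symmetric] by (simp only:)
  show "(LINT x:\<Omega>|lebesgue. (cmod (w x))\<^sup>2 * (cmod (w x))\<^sup>2) \<ge> 0"
    by (simp add: set_lebesgue_integral_def)
qed

context dg_scheme
begin

text \<open>The last clause lets a functional be evaluated on basis expansions, which hold only
  almost everywhere.\<close>

definition antilinear :: "(cfun \<Rightarrow> complex) \<Rightarrow> bool" where
  "antilinear L \<longleftrightarrow> (\<forall>u\<in>V. \<forall>v\<in>V. L (\<lambda>x. u x + v x) = L u + L v) \<and>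
     (\<forall>c. \<forall>v\<in>V. L (\<lambda>x. c * v x) = cnj c * L v) \<and>
     (\<forall>u\<in>V. \<forall>v\<in>V. (AE x in lebesgue. x \<in> \<Omega> \<longrightarrow> u x = v x) \<longrightarrow> L u = L v)"

lemma antilinear_plus: "antilinear L \<Longrightarrow> u \<in> V \<Longrightarrow> v \<in> V \<Longrightarrow> L (\<lambda>x. u x + v x) = L u + L v"
  unfolding antilinear_def by blast

lemma antilinear_scale: "antilinear L \<Longrightarrow> v \<in> V \<Longrightarrow> L (\<lambda>x. c * v x) = cnj c * L v"
  unfolding antilinear_def by blast

lemma antilinear_cong:
  "antilinear L \<Longrightarrow> u \<in> V \<Longrightarrow> v \<in> V \<Longrightarrow> AE x in lebesgue. x \<in> \<Omega> \<longrightarrow> u x = v x \<Longrightarrow> L u = L v"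
  unfolding antilinear_def by blast

lemma antilinearI:
  assumes "\<And>u v. u \<in> V \<Longrightarrow> v \<in> V \<Longrightarrow> L (\<lambda>x. u x + v x) = L u + L v"
    and "\<And>c v. v \<in> V \<Longrightarrow> L (\<lambda>x. c * v x) = cnj c * L v"
    and "\<And>u v. u \<in> V \<Longrightarrow> v \<in> V \<Longrightarrow> AE x in lebesgue. x \<in> \<Omega> \<longrightarrow> u x = v x \<Longrightarrow> L u = L v"
  shows "antilinear L"
  unfolding antilinear_def using assms by blast

lemma antilinear_add:
  assumes "antilinear L" "antilinear M" shows "antilinear (\<lambda>v. L v + M v)"
proof (rule antilinearI)
  show "L u + M u = L v + M v" if "u \<in> V" "v \<in> V" "AE x in lebesgue. x \<in> \<Omega> \<longrightarrow> u x = v x" for u v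
    using antilinear_cong[OF assms(1) that] antilinear_cong[OF assms(2) that] by (rule arg_cong2)
qed (simp_all add: antilinear_plus[OF assms(1)] antilinear_plus[OF assms(2)]
      antilinear_scale[OF assms(1)] antilinear_scale[OF assms(2)] distrib_left)

lemma antilinear_cmult:
  assumes "antilinear L" shows "antilinear (\<lambda>v. c * L v)"
proof (rule antilinearI)
  show "c * L u = c * L v" if "u \<in> V" "v \<in> V" "AE x in lebesgue. x \<in> \<Omega> \<longrightarrow> u x = v x" for u v
    using antilinear_cong[OF assms that] by (rule arg_cong)
qed (simp_all add: antilinear_plus[OF assms] antilinear_scale[OF assms] distrib_left)

lemma antilinear_form:
  assumes "w \<in> V" shows "antilinear (a w)"
  by (rule antilinearI) (use assms in \<open>simp_all add: dg_form_add_right dg_form_cmult_right dg_form_cong(2)\<close>)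

lemma antilinear_l2:
  assumes f: "set_integrable lebesgue \<Omega> f" shows "antilinear (l2_inner \<Omega> f)"
proof (rule antilinearI)
  have "set_borel_measurable lebesgue \<Omega> f"
    using f by (simp add: set_integrable_def set_borel_measurable_def)
  then show "l2_inner \<Omega> f u = l2_inner \<Omega> f v"
    if "u \<in> V" "v \<in> V" "AE x in lebesgue. x \<in> \<Omega> \<longrightarrow> u x = v x" for u v
    using that dg_space_measurable by (intro l2_inner_cong_AE) simp_all
qed (simp_all add: f l2_inner_add_right l2_inner_cmult_right dg_space_bounded_measurable)

lemma antilinear_comb:
  assumes "antilinear L" "\<And>i. i < d \<Longrightarrow> e i \<in> V"
  shows "L (comb d e x) = (\<Sum>i<d. complex_of_real (x i) * L (e i))"
  by (rule comb_linear) (simp_all add: assms antilinear_plus[OF assms(1)] antilinear_scale[OF assms(1)])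

text \<open>Testing with \<open>\<i> * v\<close> turns the imaginary part into a real part.\<close>

lemma antilinear_zero:
  assumes L: "antilinear L" and o: "orthonormal d e" and sp: "\<And>v. v \<in> V \<Longrightarrow> spanned d e v"
    and z: "\<And>i. i < d \<Longrightarrow> Re (L (e i)) = 0" and v: "v \<in> V"
  shows "L v = 0"
proof -
  have e: "e i \<in> V" if "i < d" for i using o that by (simp add: orthonormal_def)
  have re: "Re (L v) = 0" if v: "v \<in> V" for v
  proof -
    obtain x where "AE p in lebesgue. p \<in> \<Omega> \<longrightarrow> v p = comb d e x p"
      using sp[OF v] by (auto simp: spanned_def)
    moreover have "comb d e x \<in> V" using e by (rule comb_mem)
    ultimately have "L v = L (comb d e x)" using antilinear_cong[OF L v] by blast
    then show ?thesis using antilinear_comb[OF L e] z by simp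
  qed
  have "L (\<lambda>x. \<i> * v x) = cnj \<i> * L v" using L v by (rule antilinear_scale)
  then have "Im (L v) = 0" using re[OF dg_space_cmult[OF v, of \<i>]] by simp
  then show ?thesis using re[OF v] by (simp add: complex_eq_iff)
qed

text \<open>Membership in \<open>sobolev 2\<close> gives the choice in
  \<open>weak_derivative\<close> a square integrable candidate for each pure second
  derivative.\<close>

lemma laplacian_integrable:
  assumes "f \<in> sobolev 2 \<Omega>"
  shows "set_integrable lebesgue \<Omega> (laplacian \<Omega> f)"
proof -
  have "weak_derivative \<Omega> [i, i] f \<in> square_integrable \<Omega>" for i
  proof -
    have "\<exists>g. g \<in> square_integrable \<Omega> \<and> has_weak_derivative \<Omega> [i, i] f g"
      using assms unfolding sobolev_def by force
    then show ?thesis unfolding weak_derivative_def by (rule someI2_ex) blast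
  qed
  then have "set_integrable lebesgue \<Omega> (weak_derivative \<Omega> [i, i] f)" for i
    using square_integrable_integrable domain_props(3) domain_measurable by blast
  then show ?thesis
    unfolding set_integrable_def laplacian_def[abs_def] scaleR_sum_right
    by (intro Bochner_Integration.integrable_sum)
qed

text \<open>The projection is a chosen function, so a solution of its defining equation has to be
  exhibited first. In an orthonormal basis the real parts of the equations decouple and the
  coordinates of \<open>r\<close> can be read off.\<close>

lemma ritz_projection_mem:
  assumes "f \<in> sobolev 2 \<Omega>"
  shows "ritz_projection \<Omega> \<T> nrm k lam f \<in> V"
proof -
  obtain d e where o: "orthonormal d e" and sp: "\<And>v. v \<in> V \<Longrightarrow> spanned d e v"
    using orthonormal_basis by blast
  define b where "b = l2_inner \<Omega> (laplacian \<Omega> f)"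
  define r where "r = comb d e (\<lambda>i. - Re (b (e i)))"
  have r: "r \<in> V" unfolding r_def using o by (intro comb_mem) (simp add: orthonormal_def)
  have "antilinear (\<lambda>v. a r v + b v)"
    unfolding b_def by (intro antilinear_add antilinear_form antilinear_l2 r laplacian_integrable assms)
  moreover have "Re (a r (e i) + b (e i)) = 0" if "i < d" for i
    using form_comb_basis[OF o that] by (simp add: r_def)
  ultimately have "a r v + b v = 0" if "v \<in> V" for v
    using antilinear_zero[of "\<lambda>v. a r v + b v", OF _ o sp _ that] by blast
  then have "\<exists>r. r \<in> V \<and> (\<forall>v\<in>V. a r v = - l2_inner \<Omega> (laplacian \<Omega> f) v)"
    using r by (auto simp: b_def eq_neg_iff_add_eq_0)
  then show ?thesis unfolding ritz_projection_def by (rule someI2_ex) blast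
qed

section \<open>The nonlinear equation of one time step\<close>

lemma triple_bounded_measurable:
  "f \<in> V \<Longrightarrow> g \<in> V \<Longrightarrow> h \<in> V \<Longrightarrow> bounded_measurable \<Omega> (\<lambda>x. f x * cnj (g x) * h x)"
  by (intro bounded_measurable_mult bounded_measurable_cnj dg_space_bounded_measurable)

lemma triple_integrable:
  "f \<in> V \<Longrightarrow> g \<in> V \<Longrightarrow> h \<in> V \<Longrightarrow> set_integrable lebesgue \<Omega> (\<lambda>x. f x * cnj (g x) * h x)"
  using bounded_measurable_integrable domain_props(3) domain_measurable triple_bounded_measurable by blast

lemma l2_comb:
  assumes e: "\<And>i. i < d \<Longrightarrow> e i \<in> V" and v: "v \<in> V"
  shows "l2_inner \<Omega> (comb d e x) v = (\<Sum>i<d. complex_of_real (x i) * l2_inner \<Omega> (e i) v)"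
  by (rule comb_linear[of "\<lambda>f. l2_inner \<Omega> f v"])
    (use e v in \<open>auto simp: l2_inner_add l2_inner_cmult dg_space_integrable dg_space_bounded_measurable\<close>)

text \<open>The cubic term becomes a polynomial in the coordinates, which makes its continuity
  evident. Conjugation in the middle slot leaves the real coefficients unchanged.\<close>

lemma l2_triple_comb:
  assumes e: "\<And>i. i < d \<Longrightarrow> e i \<in> V" and v: "v \<in> V"
  shows "l2_inner \<Omega> (\<lambda>p. comb d e x p * cnj (comb d e x p) * comb d e x p) v =
    (\<Sum>i<d. complex_of_real (x i) * (\<Sum>j<d. complex_of_real (x j) * (\<Sum>l<d. complex_of_real (x l) *
      l2_inner \<Omega> (\<lambda>p. e i p * cnj (e j p) * e l p) v)))"
proof -
  have w: "comb d e x \<in> V" using e by (rule comb_mem)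
  let ?l = "\<lambda>f g h. l2_inner \<Omega> (\<lambda>p. f p * cnj (g p) * h p) v"
  have add: "l2_inner \<Omega> (\<lambda>p. f p * cnj (g p) * h p + f' p * cnj (g' p) * h' p) v = ?l f g h + ?l f' g' h'"
    if "f \<in> V" "g \<in> V" "h \<in> V" "f' \<in> V" "g' \<in> V" "h' \<in> V" for f g h f' g' h'
    by (intro l2_inner_add triple_integrable dg_space_bounded_measurable[OF v] that)
  have cmult: "l2_inner \<Omega> (\<lambda>p. c * (f p * cnj (g p) * h p)) v = c * ?l f g h" for c f g h
    by (rule l2_inner_cmult)
  have 1: "?l (comb d e x) g h = (\<Sum>i<d. complex_of_real (x i) * ?l (e i) g h)"
    if "g \<in> V" "h \<in> V" for g h
  proof (rule comb_linear[of "\<lambda>f. ?l f g h"])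
    show "l2_inner \<Omega> (\<lambda>p. (f p + f' p) * cnj (g p) * h p) v = ?l f g h + ?l f' g h"
      if "f \<in> V" "f' \<in> V" for f f'
      unfolding add[OF that(1) \<open>g \<in> V\<close> \<open>h \<in> V\<close> that(2) \<open>g \<in> V\<close> \<open>h \<in> V\<close>, symmetric]
      by (simp only: distrib_right)
    show "l2_inner \<Omega> (\<lambda>p. complex_of_real c * f p * cnj (g p) * h p) v = complex_of_real c * ?l f g h" for c f
      unfolding cmult[symmetric] by (simp only: mult.assoc)
  qed (rule e)
  have 2: "?l f (comb d e x) h = (\<Sum>i<d. complex_of_real (x i) * ?l f (e i) h)"
    if "f \<in> V" "h \<in> V" for f h
  proof (rule comb_linear[of "\<lambda>g. ?l f g h"])
    show "l2_inner \<Omega> (\<lambda>p. f p * cnj (g p + g' p) * h p) v = ?l f g h + ?l f g' h"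
      if "g \<in> V" "g' \<in> V" for g g'
      unfolding add[OF \<open>f \<in> V\<close> that(1) \<open>h \<in> V\<close> \<open>f \<in> V\<close> that(2) \<open>h \<in> V\<close>, symmetric]
      by (simp only: distrib_right distrib_left complex_cnj_add)
    show "l2_inner \<Omega> (\<lambda>p. f p * cnj (complex_of_real c * g p) * h p) v = complex_of_real c * ?l f g h" for c g
      unfolding cmult[symmetric] by (simp only: complex_cnj_mult complex_cnj_complex_of_real mult.assoc mult.left_commute)
  qed (rule e)
  have 3: "?l f g (comb d e x) = (\<Sum>i<d. complex_of_real (x i) * ?l f g (e i))"
    if "f \<in> V" "g \<in> V" for f g
  proof (rule comb_linear[of "\<lambda>h. ?l f g h"])
    show "l2_inner \<Omega> (\<lambda>p. f p * cnj (g p) * (h p + h' p)) v = ?l f g h + ?l f g h'"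
      if "h \<in> V" "h' \<in> V" for h h'
      unfolding add[OF \<open>f \<in> V\<close> \<open>g \<in> V\<close> that(1) \<open>f \<in> V\<close> \<open>g \<in> V\<close> that(2), symmetric]
      by (simp only: distrib_left)
    show "l2_inner \<Omega> (\<lambda>p. f p * cnj (g p) * (complex_of_real c * h p)) v = complex_of_real c * ?l f g h" for c h
      unfolding cmult[symmetric] by (simp only: mult.assoc mult.left_commute)
  qed (rule e)
  show ?thesis
    unfolding 1[OF w w]
  proof (intro sum.cong refl arg_cong2[where f = times])
    fix i assume "i \<in> {..<d}"
    then have i: "e i \<in> V" using e by simp
    show "?l (e i) (comb d e x) (comb d e x) = (\<Sum>j<d. complex_of_real (x j) *
        (\<Sum>l<d. complex_of_real (x l) * ?l (e i) (e j) (e l)))"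
      unfolding 2[OF i w]
    proof (intro sum.cong refl arg_cong2[where f = times])
      fix j assume "j \<in> {..<d}"
      then show "?l (e i) (e j) (comb d e x) = (\<Sum>l<d. complex_of_real (x l) * ?l (e i) (e j) (e l))"
        using 3[OF i] e by simp
    qed
  qed
qed

text \<open>The zero theorem is applied to x -> Re (\<Phi> w (e i)) with
  \<open>w = comb d e x\<close>. By antilinearity the pairing of this field with \<open>x\<close> is
  Re (\<Phi> w w), and a common zero of the real components solves the complex equation for every
  test function.\<close>

lemma crank_nicolson_step:
  fixes \<tau> \<nu> \<kappa> \<alpha> \<beta> \<gamma> :: real
  assumes u: "u \<in> V" and \<tau>: "\<tau> > 0" and \<nu>: "\<nu> > 0" and \<kappa>: "\<kappa> \<ge> 0" and \<gamma>: "\<tau> * \<gamma> < 2"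
  shows "\<exists>w\<in>V. \<forall>v\<in>V. complex_of_real (2 / \<tau>) * (l2_inner \<Omega> w v - l2_inner \<Omega> u v)
      + (complex_of_real \<nu> + \<i> * complex_of_real \<alpha>) * a w v
      + (complex_of_real \<kappa> + \<i> * complex_of_real \<beta>) * l2_inner \<Omega> (\<lambda>x. w x * cnj (w x) * w x) v
      - complex_of_real \<gamma> * l2_inner \<Omega> w v = 0"
proof -
  obtain d e where o: "orthonormal d e" and sp: "\<And>v. v \<in> V \<Longrightarrow> spanned d e v"
    using orthonormal_basis by blast
  have e: "e i \<in> V" if "i < d" for i using o that by (simp add: orthonormal_def)
  \<comment> \<open>Differences are written as sums with factors -1 and - \<gamma>, so that the
    closure rules for antilinear functionals apply.\<close>
  define \<Phi> where "\<Phi> w v = complex_of_real (2 / \<tau>) * (l2_inner \<Omega> w v + (-1) * l2_inner \<Omega> u v)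
      + (complex_of_real \<nu> + \<i> * complex_of_real \<alpha>) * a w v
      + (complex_of_real \<kappa> + \<i> * complex_of_real \<beta>) * l2_inner \<Omega> (\<lambda>x. w x * cnj (w x) * w x) v
      + complex_of_real (- \<gamma>) * l2_inner \<Omega> w v" for w v
  have anti: "antilinear (\<Phi> w)" if "w \<in> V" for w
    unfolding \<Phi>_def
    by (intro antilinear_add antilinear_cmult antilinear_form antilinear_l2 dg_space_integrable[OF that]
        dg_space_integrable[OF u] triple_integrable that)
  have w: "comb d e x \<in> V" for x using e by (rule comb_mem)
  \<comment> \<open>On the sphere every coordinate is at most R in modulus, so Re (u,w) \<le> R S.
    The radius satisfies \<nu> R = (2/\<tau>) S + \<nu>, whence \<nu> R^2 exceeds (2/\<tau>) R S by
    the positive amount \<nu> R.\<close>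
  define S where "S = (\<Sum>i<d. \<bar>Re (l2_inner \<Omega> u (e i))\<bar>)"
  define R where "R = 2 / \<tau> * S / \<nu> + 1"
  have S: "S \<ge> 0" unfolding S_def by (intro sum_nonneg) simp
  have R: "R > 0" using S \<tau> \<nu> unfolding R_def by (intro add_nonneg_pos divide_nonneg_pos mult_nonneg_nonneg) auto
  have cx: "continuous_on UNIV (\<lambda>x::nat \<Rightarrow> real. x j)" for j
    by (rule continuous_on_product_then_coordinatewise) (rule continuous_on_id)
  have "\<exists>x. \<forall>i<d. Re (\<Phi> (comb d e x) (e i)) = 0"
  proof (rule coercive_zero[OF _ R])
    fix i assume i: "i < d"
    have eqs: "l2_inner \<Omega> (comb d e x) (e i) = (\<Sum>j<d. complex_of_real (x j) * l2_inner \<Omega> (e j) (e i))"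
      "a (comb d e x) (e i) = (\<Sum>j<d. complex_of_real (x j) * a (e j) (e i))"
      "l2_inner \<Omega> (\<lambda>p. comb d e x p * cnj (comb d e x p) * comb d e x p) (e i) =
        (\<Sum>i'<d. complex_of_real (x i') * (\<Sum>j<d. complex_of_real (x j) * (\<Sum>l<d. complex_of_real (x l) *
        l2_inner \<Omega> (\<lambda>p. e i' p * cnj (e j p) * e l p) (e i))))" for x
      using e i by (simp_all add: l2_comb form_comb_left l2_triple_comb)
    show "continuous_on UNIV (\<lambda>x. Re (\<Phi> (comb d e x) (e i)))"
      unfolding \<Phi>_def eqs
      by (intro continuous_on_Re continuous_on_add continuous_on_mult continuous_on_sum
          continuous_on_of_real continuous_on_const cx)
  next
    fix x :: "nat \<Rightarrow> real" assume x: "(\<Sum>i<d. (x i)\<^sup>2) = R\<^sup>2"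
    let ?w = "comb d e x"
    obtain p where p: "l2_inner \<Omega> ?w ?w = complex_of_real p" "p \<ge> 0" by (rule l2_inner_self)
    obtain q where q: "l2_inner \<Omega> (\<lambda>x. ?w x * cnj (?w x) * ?w x) ?w = complex_of_real q" "q \<ge> 0"
      by (rule l2_inner_cubic_self)
    have le: "\<bar>x i\<bar> \<le> R" if "i < d" for i
    proof -
      have "(x i)\<^sup>2 \<le> R\<^sup>2" unfolding x[symmetric] by (rule member_le_sum) (use that in auto)
      then show ?thesis using R by (metis abs_le_square_iff abs_of_pos)
    qed
    have "Re (l2_inner \<Omega> u ?w) = (\<Sum>i<d. x i * Re (l2_inner \<Omega> u (e i)))"
      using antilinear_comb[OF antilinear_l2[OF dg_space_integrable[OF u]] e] by simp
    also have "\<dots> \<le> (\<Sum>i<d. R * \<bar>Re (l2_inner \<Omega> u (e i))\<bar>)"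
    proof (rule sum_mono)
      fix i assume "i \<in> {..<d}"
      then have "\<bar>x i\<bar> * \<bar>Re (l2_inner \<Omega> u (e i))\<bar> \<le> R * \<bar>Re (l2_inner \<Omega> u (e i))\<bar>"
        using le by (intro mult_right_mono) auto
      then show "x i * Re (l2_inner \<Omega> u (e i)) \<le> R * \<bar>Re (l2_inner \<Omega> u (e i))\<bar>"
        using abs_ge_self[of "x i * Re (l2_inner \<Omega> u (e i))"] unfolding abs_mult by linarith
    qed
    also have "\<dots> = R * S" by (simp add: S_def sum_distrib_left)
    finally have uw: "2 / \<tau> * Re (l2_inner \<Omega> u ?w) \<le> 2 / \<tau> * (R * S)"
      using \<tau> by (intro mult_left_mono) auto
    have "\<nu> * R = 2 / \<tau> * S + \<nu>" using \<nu> unfolding R_def by (simp add: field_simps)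
    then have "\<nu> * R * R = 2 / \<tau> * (R * S) + \<nu> * R" by (simp add: algebra_simps)
    moreover have "\<nu> * R > 0" using \<nu> R by simp
    ultimately have big: "2 / \<tau> * (R * S) < \<nu> * R\<^sup>2" by (simp add: power2_eq_square mult.assoc)
    \<comment> \<open>The step restriction enters here: mass and reaction terms together are
      nonnegative.\<close>
    have "\<gamma> < 2 / \<tau>" using \<gamma> \<tau> by (simp add: field_simps)
    then have pp: "(2 / \<tau> - \<gamma>) * p \<ge> 0" using p(2) by simp
    \<comment> \<open>The form is real on the diagonal, so \<alpha> contributes nothing to the real
      part, and orthonormality gives its exact value on the sphere.\<close>
    have aw: "a ?w ?w = complex_of_real (R\<^sup>2)"
      using form_comb_self[OF o, of x] form_real[of ?w] x by (simp add: complex_eq_iff)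
    have "(\<Sum>i<d. Re (\<Phi> ?w (e i)) * x i) = Re (\<Phi> ?w ?w)"
    proof -
      have "\<Phi> ?w ?w = (\<Sum>i<d. complex_of_real (x i) * \<Phi> ?w (e i))"
        by (rule antilinear_comb[OF anti[OF w]]) (rule e)
      then show ?thesis by (simp add: mult.commute)
    qed
    also have "\<dots> = (2 / \<tau> - \<gamma>) * p - 2 / \<tau> * Re (l2_inner \<Omega> u ?w) + \<nu> * R\<^sup>2 + \<kappa> * q"
      unfolding \<Phi>_def p(1) q(1) aw by (simp add: algebra_simps)
    also have "\<dots> > 0" using uw big pp mult_nonneg_nonneg[OF \<kappa> q(2)] by linarith
    finally show "0 < (\<Sum>i<d. Re (\<Phi> ?w (e i)) * x i)" .
  qed
  then obtain x where x: "\<And>i. i < d \<Longrightarrow> Re (\<Phi> (comb d e x) (e i)) = 0" by blast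
  have "\<Phi> (comb d e x) v = 0" if "v \<in> V" for v
    using antilinear_zero[OF anti[OF w] o sp x that] .
  moreover have "\<Phi> w v = complex_of_real (2 / \<tau>) * (l2_inner \<Omega> w v - l2_inner \<Omega> u v)
      + (complex_of_real \<nu> + \<i> * complex_of_real \<alpha>) * a w v
      + (complex_of_real \<kappa> + \<i> * complex_of_real \<beta>) * l2_inner \<Omega> (\<lambda>x. w x * cnj (w x) * w x) v
      - complex_of_real \<gamma> * l2_inner \<Omega> w v" for w v
    by (simp add: \<Phi>_def)
  ultimately show ?thesis using w[of x] by (intro bexI[of _ "comb d e x"] ballI) simp_all
qed

text \<open>The new value is the reflection \<open>u' = 2 w - u\<close> of the old one in the solved
  average. Averages then agree pointwise, so the nonlinear term carries over without further
  estimates.\<close>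

lemma crank_nicolson_update:
  fixes \<tau> \<nu> \<kappa> \<alpha> \<beta> \<gamma> :: real
  assumes u: "u \<in> V" and \<tau>: "\<tau> > 0" and \<nu>: "\<nu> > 0" and \<kappa>: "\<kappa> \<ge> 0" and \<gamma>: "\<tau> * \<gamma> < 2"
  shows "\<exists>u'\<in>V. \<forall>v\<in>V. l2_inner \<Omega> (\<lambda>x. (u' x - u x) / complex_of_real \<tau>) v
      + (complex_of_real \<nu> + \<i> * complex_of_real \<alpha>) * a (\<lambda>x. (u' x + u x) / 2) v
      + (complex_of_real \<kappa> + \<i> * complex_of_real \<beta>) * l2_inner \<Omega>
          (\<lambda>x. (complex_of_real (cmod ((u' x + u x) / 2)))\<^sup>2 * ((u' x + u x) / 2)) v
      - complex_of_real \<gamma> * l2_inner \<Omega> (\<lambda>x. (u' x + u x) / 2) v = 0"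
proof -
  obtain w where w: "w \<in> V" and eq: "\<And>v. v \<in> V \<Longrightarrow>
      complex_of_real (2 / \<tau>) * (l2_inner \<Omega> w v - l2_inner \<Omega> u v)
      + (complex_of_real \<nu> + \<i> * complex_of_real \<alpha>) * a w v
      + (complex_of_real \<kappa> + \<i> * complex_of_real \<beta>) * l2_inner \<Omega> (\<lambda>x. w x * cnj (w x) * w x) v
      - complex_of_real \<gamma> * l2_inner \<Omega> w v = 0"
    using crank_nicolson_step[OF assms] by blast
  define u' where "u' = (\<lambda>x. 2 * w x + (-1) * u x)"
  have u': "u' \<in> V" unfolding u'_def by (intro dg_space_add dg_space_cmult w u)
  have avg: "(u' x + u x) / 2 = w x" for x by (simp add: u'_def)
  have cub: "(complex_of_real (cmod (w x)))\<^sup>2 * w x = w x * cnj (w x) * w x" for x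
    unfolding of_real_power[symmetric] complex_norm_square ..
  have diff: "l2_inner \<Omega> (\<lambda>x. (u' x - u x) / complex_of_real \<tau>) v
      = complex_of_real (2 / \<tau>) * (l2_inner \<Omega> w v - l2_inner \<Omega> u v)" if v: "v \<in> V" for v
  proof -
    have "(\<lambda>x. (u' x - u x) / complex_of_real \<tau>) = (\<lambda>x. complex_of_real (2 / \<tau>) * (w x + (-1) * u x))"
      by (simp add: u'_def fun_eq_iff field_simps)
    moreover have "l2_inner \<Omega> (\<lambda>x. w x + (-1) * u x) v = l2_inner \<Omega> w v + l2_inner \<Omega> (\<lambda>x. (-1) * u x) v"
      by (intro l2_inner_add dg_space_bounded_measurable[OF v] dg_space_integrable[OF w]
          dg_space_integrable[OF dg_space_cmult[OF u]])
    ultimately show ?thesis by (simp only: l2_inner_cmult) simp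
  qed
  show ?thesis
  proof (rule bexI[OF _ u'], rule ballI)
    fix v assume v: "v \<in> V"
    show "l2_inner \<Omega> (\<lambda>x. (u' x - u x) / complex_of_real \<tau>) v
      + (complex_of_real \<nu> + \<i> * complex_of_real \<alpha>) * a (\<lambda>x. (u' x + u x) / 2) v
      + (complex_of_real \<kappa> + \<i> * complex_of_real \<beta>) * l2_inner \<Omega>
          (\<lambda>x. (complex_of_real (cmod ((u' x + u x) / 2)))\<^sup>2 * ((u' x + u x) / 2)) v
      - complex_of_real \<gamma> * l2_inner \<Omega> (\<lambda>x. (u' x + u x) / 2) v = 0"
      unfolding avg cub diff[OF v] by (rule eq[OF v])
  qed
qed
end

theorem theorem3p1:
  fixes \<Omega> :: "(real^2) set"
    and T \<nu> \<kappa> \<alpha> \<beta> \<gamma> lam \<tau> :: real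
    and k N m :: nat
    and u0 :: "real^2 \<Rightarrow> complex"
    and \<K> :: "nat \<Rightarrow> (real^2) set set"
    and nrm :: "nat \<Rightarrow> (real^2) set \<Rightarrow> real^2"
  assumes domain: "convex_polygonal_domain \<Omega>"
    and params: "T > 0" "\<nu> > 0" "\<kappa> > 0" "k \<ge> 1"
    and initial: "u0 \<in> sobolev (k + 1) \<Omega>" "continuous_on (closure \<Omega>) u0"
      "\<forall>x\<in>frontier \<Omega>. u0 x = 0"
    and meshes: "\<forall>j. mesh_of \<Omega> (\<K> j)" "quasi_uniform \<K>"
    and normals: "\<forall>j. unit_normals \<Omega> (\<K> j) (nrm j)"
    and penalty: "coercive_and_bounded \<Omega> \<K> nrm k lam"
    and time_grid: "N \<ge> 1" "\<tau> = T / real N"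
    and step: "\<tau> * \<gamma> < 2"
  shows "\<exists>u :: nat \<Rightarrow> real^2 \<Rightarrow> complex.
    u 0 = ritz_projection \<Omega> (\<K> m) (nrm m) k lam u0 \<and>
    (\<forall>n\<in>{1..N}. u n \<in> dg_space \<Omega> (\<K> m) k \<and>
      (\<forall>v\<in>dg_space \<Omega> (\<K> m) k.
        l2_inner \<Omega> (backward_diff \<tau> u n) v
        + (complex_of_real \<nu> + \<i> * complex_of_real \<alpha>)
            * dg_form \<Omega> (\<K> m) (nrm m) lam (time_avg u n) v
        + (complex_of_real \<kappa> + \<i> * complex_of_real \<beta>)
            * l2_inner \<Omega> (\<lambda>x. (complex_of_real (cmod (time_avg u n x)))\<^sup>2 * time_avg u n x) v
        - complex_of_real \<gamma> * l2_inner \<Omega> (time_avg u n) v = 0))"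
proof -
  obtain C where C: "C > 0" "\<And>v. v \<in> dg_space \<Omega> (\<K> m) k \<Longrightarrow>
      C * (dg_norm \<Omega> (\<K> m) (nrm m) v)\<^sup>2 \<le> Re (dg_form \<Omega> (\<K> m) (nrm m) lam v v)"
    using penalty unfolding coercive_and_bounded_def by blast
  interpret dg_scheme \<Omega> "\<K> m" "nrm m" k lam C
    using domain meshes normals C by unfold_locales auto
  have \<tau>: "\<tau> > 0" using params time_grid by simp
  let ?E = "\<lambda>u u' v. l2_inner \<Omega> (\<lambda>x. (u' x - u x) / complex_of_real \<tau>) v
      + (complex_of_real \<nu> + \<i> * complex_of_real \<alpha>) * a (\<lambda>x. (u' x + u x) / 2) v
      + (complex_of_real \<kappa> + \<i> * complex_of_real \<beta>) * l2_inner \<Omega>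
          (\<lambda>x. (complex_of_real (cmod ((u' x + u x) / 2)))\<^sup>2 * ((u' x + u x) / 2)) v
      - complex_of_real \<gamma> * l2_inner \<Omega> (\<lambda>x. (u' x + u x) / 2) v"
  \<comment> \<open>The implication makes the statement total in \<open>u\<close>, so that choice
    yields a step map on all functions.\<close>
  have "\<forall>u. \<exists>u'. u \<in> V \<longrightarrow> u' \<in> V \<and> (\<forall>v\<in>V. ?E u u' v = 0)"
    using crank_nicolson_update[OF _ \<tau> params(2) less_imp_le[OF params(3)] step, of _ \<alpha> \<beta>] by blast
  from choice[OF this] obtain F where
    F: "\<And>u. u \<in> V \<Longrightarrow> F u \<in> V" "\<And>u v. u \<in> V \<Longrightarrow> v \<in> V \<Longrightarrow> ?E u (F u) v = 0"
    by blast
  define u where "u n = (F ^^ n) (ritz_projection \<Omega> (\<K> m) (nrm m) k lam u0)" for n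
  \<comment> \<open>Since k + 1 is at least 2, the weak derivatives in the Laplacian exist.\<close>
  have "u0 \<in> sobolev 2 \<Omega>" using initial(1) params(4) by (auto simp: sobolev_def)
  then have "u 0 \<in> V" using ritz_projection_mem by (simp add: u_def)
  then have uV: "u n \<in> V" for n by (induction n) (auto simp: u_def F(1))
  have "?E (u (n - 1)) (u n) v = 0" if "n \<in> {1..N}" "v \<in> V" for n v
  proof -
    \<comment> \<open>On the grid n is at least 1, so the truncated difference \<open>n - 1\<close>
      is a genuine predecessor.\<close>
    have "u n = F (u (n - 1))" using that(1) by (cases n) (auto simp: u_def)
    then show ?thesis using F(2)[OF uV that(2), of "n - 1"] by (simp only:)
  qed
  then show ?thesis
    using uV by (intro exI[of _ u]) (simp add: u_def[of 0] backward_diff_def[abs_def] time_avg_def[abs_def])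
qed

end
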